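(* Let $u$ be the viscosity solution of the boundary value problem described in the context. Let $X'=(t',x')\in Q$ and let $R>0$ and $0<\bar t<t'$ be such that $\overline{B_{\bar t}(X',R)}\subset Q$ and $$u(t,x)=\min_{y\in\Omega}\left[(t-\bar t)L\left(\frac{x-y}{t-\bar t}\right)+u(\bar t,y)\right]\qquad\text{for each }(t,x)\in B_{\bar t}(X',R).$$ Then there exists $T'>0$ such that for every $(t_0,x_0)\in B_{\bar t}(X',\frac R2)$ the energy-minimizing generalized characteristic $\xi$ starting from $(t_0,x_0)$ (defined in the context) satisfies $$\min_{(\tau,p)\in D^+u(\xi(s))}F(\tau,p)\le\left(\frac{t_0-\bar t}{s-\bar t}\right)^2\min_{(\tau_0,p_0)\in D^+u(t_0,x_0)}F(\tau_0,p_0)$$ for every $s\in[t_0,t_0+T')$.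
   Context: Setting. $\Omega\subset\mathbb{R}^n$ is an open set, $Q=(0,+\infty)\times\Omega\subset\mathbb{R}^{n+1}$. $A$ is a symmetric positive definite real $n\times n$ matrix, $H(p)=\frac12 Ap\cdot p$ for $p\in\mathbb{R}^n$, and $L(q)=\frac12A^{-1}q\cdot q$ is its Legendre transform. $\varphi:\overline Q\to\mathbb{R}$ is Lipschitz continuous and satisfies the compatibility condition $$\varphi(t,x)-\varphi(s,y)\le (t-s)L\left(\frac{x-y}{t-s}\right)\quad\text{for all }(t,x),(s,y)\in\partial Q\text{ with }t>s\ge0.$$ $u\in \mathrm{Lip}(\overline Q)$ is the unique viscosity solution of $u_t+H(\nabla u)=0$ in $Q$, $u=\varphi$ on $\partial Q$ (here $\nabla$ is the gradient in $x$); it is given by the Hopf formula $$u(t,x)=\min_{(s,y)\in\partial Q,\ s<t}\left[(t-s)L\left(\frac{x-y}{t-s}\right)+\varphi(s,y)\right],\quad (t,x)\in Q.$$ Equivalently, $u$ is the unique Lipschitz function on $\overline Q$ that is locally semiconcave in $Q$, solves the equation almost everywhere in $Q$ and equals $\varphi$ on $\partial Q$. Notation. $B(X,R)$ is the ball of centre $X\in\mathbb{R}^{n+1}$ and radius $R$, and $B_{\bar t}(X,R)=((\bar t,+\infty)\times\mathbb{R}^n)\cap B(X,R)$. The superdifferential of $u$ at $X\in Q$ is $$D^+u(X)=\left\{P\in\mathbb{R}^{n+1}:\limsup_{Y\to X}\frac{u(Y)-u(X)-\langle P,Y-X\rangle}{|Y-X|}\le0\right\},$$ whose elements are written $P=(\tau,p)\in\mathbb{R}\times\mathbb{R}^n$;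 it is a nonempty compact convex set. The full Hamiltonian is $F(\tau,p)=\tau+H(p)$. Energy-minimizing generalized characteristic. For $(t_0,x_0)\in Q$ it is the Lipschitz continuous arc $\xi$ with values in $Q$, defined on an interval $[t_0,t_0+T_0)$, $T_0>0$, such that $\xi(t_0)=(t_0,x_0)$, the right derivative $\frac{\mathrm{d}}{\mathrm{d}s^+}\xi(s)$ exists for all $s$ in the interval, is right-continuous in $s$ and equals $(1,\nabla H(p(s)))$, where $(\tau(s),p(s))\in D^+u(\xi(s))$ is the minimizer, $F(\tau(s),p(s))=\min_{(\tau,p)\in D^+u(\xi(s))}F(\tau,p)$. Equivalently, $$\xi(s)=(t_0,x_0)+\int_{t_0}^s\big(1,\nabla H(p(r))\big)\,\mathrm{d}r .$$ Such an arc exists and is uniquely determined by $(t_0,x_0)$. In the claim it is part of the conclusion that $T'$ is independent of $(t_0,x_0)$ and that $\xi$ is defined on $[t_0,t_0+T')$. *)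

theory Defs
  imports "HOL-Analysis.Analysis"
begin

text \<open>
  \<open>has_min f S m\<close>: the minimum of \<open>f\<close> over \<open>S\<close> is attained and equals \<open>m\<close>.  All minima are
  stated in this way, so that no value is attached to a minimum that does not exist.
\<close>

definition has_min :: "('a \<Rightarrow> real) \<Rightarrow> 'a set \<Rightarrow> real \<Rightarrow> bool" where
  "has_min f S m \<longleftrightarrow> (\<exists>y\<in>S. f y = m) \<and> (\<forall>y\<in>S. m \<le> f y)"

definition gradient :: "('a::real_inner \<Rightarrow> real) \<Rightarrow> 'a \<Rightarrow> 'a" where
  "gradient f x = (THE D. GDERIV f x :> D)"

definition superdifferential :: "('a::real_inner \<Rightarrow> real) \<Rightarrow> 'a \<Rightarrow> 'a set" where
  "superdifferential u X =
     {P. Limsup (at X) (\<lambda>Y. ereal ((u Y - u X - P \<bullet> (Y - X)) / norm (Y - X))) \<le> 0}"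

definition subdifferential :: "('a::real_inner \<Rightarrow> real) \<Rightarrow> 'a \<Rightarrow> 'a set" where
  "subdifferential u X =
     {P. Liminf (at X) (\<lambda>Y. ereal ((u Y - u X - P \<bullet> (Y - X)) / norm (Y - X))) \<ge> 0}"

text \<open>
  Viscosity solutions of \<open>F(Du) = 0\<close> in an open set, in the formulation with semidifferentials.
\<close>

definition viscosity_solution :: "('a::real_inner \<Rightarrow> real) \<Rightarrow> 'a set \<Rightarrow> ('a \<Rightarrow> real) \<Rightarrow> bool" where
  "viscosity_solution F Q u \<longleftrightarrow>
     continuous_on Q u \<and>
     (\<forall>X\<in>Q. \<forall>P\<in>superdifferential u X. F P \<le> 0) \<and>
     (\<forall>X\<in>Q. \<forall>P\<in>subdifferential u X. F P \<ge> 0)"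

definition sym_pos_def :: "real^'n^'n \<Rightarrow> bool" where
  "sym_pos_def A \<longleftrightarrow> transpose A = A \<and> (\<forall>p. p \<noteq> 0 \<longrightarrow> (A *v p) \<bullet> p > 0)"

definition hamiltonian :: "real^'n^'n \<Rightarrow> real^'n \<Rightarrow> real" where
  "hamiltonian A p = 1 / 2 * ((A *v p) \<bullet> p)"

definition lagrangian :: "real^'n^'n \<Rightarrow> real^'n \<Rightarrow> real" where
  "lagrangian A q = 1 / 2 * ((matrix_inv A *v q) \<bullet> q)"

definition full_hamiltonian :: "real^'n^'n \<Rightarrow> real \<times> (real^'n) \<Rightarrow> real" where
  "full_hamiltonian A P = fst P + hamiltonian A (snd P)"

lemma gradient_hamiltonian:
  assumes "transpose A = A"
  shows "gradient (hamiltonian A) p = A *v p"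
proof -
  have *: "(A *v h) \<bullet> p = h \<bullet> (A *v p)" for h
    by (metis assms dot_lmul_matrix inner_commute vector_transpose_matrix)
  have "(hamiltonian A has_derivative (\<lambda>h. 1 / 2 * ((A *v p) \<bullet> h + (A *v h) \<bullet> p))) (at p)"
    unfolding hamiltonian_def[abs_def]
    by (intro derivative_intros
          bounded_linear.has_derivative[OF matrix_vector_mul_bounded_linear])
  then have "GDERIV (hamiltonian A) p :> A *v p"
    unfolding gderiv_def using * by (simp add: inner_commute[of p] inner_commute[of "A *v p"])
  moreover have "D = A *v p" if "GDERIV (hamiltonian A) p :> D" for D
  proof -
    have "(\<lambda>h. h \<bullet> D) = (\<lambda>h. h \<bullet> (A *v p))"
      using that calculation unfolding gderiv_def by (rule has_derivative_unique)
    then show ?thesis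
      by (metis vector_eq_ldot)
  qed
  ultimately show ?thesis
    unfolding gradient_def by (blast intro: the_equality)
qed

text \<open>The domain \<open>Q = (0, \<infinity>) \<times> \<Omega>\<close>.\<close>

definition cylinder :: "(real^'n) set \<Rightarrow> (real \<times> (real^'n)) set" where
  "cylinder \<Omega> = {0<..} \<times> \<Omega>"

definition compatible ::
  "real^'n^'n \<Rightarrow> (real^'n) set \<Rightarrow> (real \<times> (real^'n) \<Rightarrow> real) \<Rightarrow> bool" where
  "compatible A \<Omega> \<phi> \<longleftrightarrow>
     (\<forall>t x s y. (t, x) \<in> frontier (cylinder \<Omega>) \<longrightarrow> (s, y) \<in> frontier (cylinder \<Omega>) \<longrightarrow>
        t > s \<longrightarrow> s \<ge> 0 \<longrightarrow>
        \<phi> (t, x) - \<phi> (s, y) \<le> (t - s) * lagrangian A ((x - y) /\<^sub>R (t - s)))"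

definition upper_ball :: "real \<Rightarrow> real \<times> (real^'n) \<Rightarrow> real \<Rightarrow> (real \<times> (real^'n)) set" where
  "upper_ball tbar X R = ({tbar<..} \<times> UNIV) \<inter> ball X R"

text \<open>
  Energy-minimizing generalized characteristic starting from \<open>X0 = (t0, x0)\<close>, on the interval
  \<open>[t0, t0 + T)\<close>; the values of \<open>\<xi>\<close> outside this interval are irrelevant.  By strict convexity of
  \<open>H\<close> the minimizer \<open>P s\<close> is determined by \<open>\<xi> s\<close>.
\<close>

definition energy_min_characteristic ::
  "real^'n^'n \<Rightarrow> (real^'n) set \<Rightarrow> (real \<times> (real^'n) \<Rightarrow> real) \<Rightarrow> real \<times> (real^'n) \<Rightarrow> real \<Rightarrow>
     (real \<Rightarrow> real \<times> (real^'n)) \<Rightarrow> bool" where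
  "energy_min_characteristic A \<Omega> u X0 T \<xi> \<longleftrightarrow>
     (let t0 = fst X0; I = {t0..<t0 + T} in
        T > 0 \<and> \<xi> t0 = X0 \<and> \<xi> ` I \<subseteq> cylinder \<Omega> \<and> (\<exists>C. C-lipschitz_on I \<xi>) \<and>
        (\<exists>P. \<forall>s\<in>I.
           P s \<in> superdifferential u (\<xi> s) \<and>
           has_min (full_hamiltonian A) (superdifferential u (\<xi> s)) (full_hamiltonian A (P s)) \<and>
           (\<xi> has_vector_derivative (1, gradient (hamiltonian A) (snd (P s)))) (at_right s) \<and>
           continuous (at_right s) (\<lambda>r. (1::real, gradient (hamiltonian A) (snd (P r))))))"

end

theory Submission
  imports Defs
begin

text \<open>
  Write \<open>\<tau> = t - tbar\<close> for the age of a point \<open>(t, x)\<close>.  As \<open>L\<close> is quadratic, multiplying the Hopf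
  formula by \<open>\<tau>\<close> exhibits \<open>\<tau> u - L(x)\<close> as a minimum of functions that are affine in \<open>(t, x)\<close>, so this
  function is jointly concave (\<open>semiconcave\<close>).  Consequently a supergradient \<open>P\<close> of \<open>u\<close> at \<open>X\<close> satisfies
  a global inequality (\<open>superdifferential_eq_supergradients\<close>), and supergradients \<open>P\<close> at \<open>X\<close> and \<open>Q\<close> at
  \<open>Y\<close> satisfy the weighted monotonicity relation (\<open>supergradient_monotone\<close>)
  \<open>\<tau>\<^sub>Y\<^sup>2 \<langle>Q, Y - X\<rangle> - \<tau>\<^sub>X\<^sup>2 \<langle>P, Y - X\<rangle> \<le> (\<tau>\<^sub>X + \<tau>\<^sub>Y) L(y - x)\<close>.  Behind the weights is the substitution
  \<open>\<sigma> = - 1 / \<tau>\<close>, \<open>z = x / \<tau>\<close>: it turns \<open>u - L(x) / \<tau>\<close> into a concave solution of the same equation, and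
  \<open>\<tau>\<^sup>2 F\<close> is the energy of that solution.

  Consider one implicit Euler step \<open>x\<^sub>1 = x\<^sub>0 + (t\<^sub>1 - t\<^sub>0) A p\<^sub>1\<close>, with \<open>(\<theta>\<^sub>1, p\<^sub>1)\<close> a supergradient at the
  \<^emph>\<open>end\<close> point.  Monotonicity has two exact consequences, without any error in the step size.  First,
  \<open>\<tau>\<^sub>1\<^sup>2 F(\<theta>\<^sub>1, p\<^sub>1) \<le> \<tau>\<^sub>0\<^sup>2 F(P)\<close> for \<^emph>\<open>every\<close> supergradient \<open>P\<close> at the starting point, in particular for the
  energy minimizer (\<open>euler_step_energy\<close>): this is the inequality of the theorem for a single step.
  Second, the distance of two polygons on the same time grid, divided by \<open>\<tau>\<close>, does not grow
  (\<open>euler_step_nonexpansive\<close>).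

  Let the mesh tend to \<open>0\<close>.  The polygons from \<open>X\<^sub>0\<close> have a pointwise cluster curve.  By the second
  property, polygons restarted \<^emph>\<open>exactly\<close> at a point of this curve follow it as well
  (\<open>euler_limit_exists\<close>).  The minimum of \<open>F\<close> over the superdifferential is only lower semicontinuous,
  which suffices at the end of an arc but not at its beginning; the restart removes this obstacle, so
  \<open>\<tau>\<^sup>2 min F\<close> is nonincreasing along the curve.  Since the minimizer of \<open>F\<close> is unique and the
  superdifferential is upper semicontinuous, supergradients near \<open>X\<close> whose weighted energy does not
  exceed that of \<open>X\<close> are close to the minimizer at \<open>X\<close> (\<open>low_energy_near_minimizer\<close>).  This gives the
  right derivative \<open>(1, A p)\<close> of the curve, with the minimizing \<open>p\<close>, and its right continuity: the
  curve is an energy-minimizing characteristic.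

  Conversely, the monotonicity relation shows that the squared distance of two characteristics, measured
  by \<open>L\<close> and divided by \<open>\<tau>\<^sup>2\<close>, has a nonpositive right derivative.  So each characteristic
  coincides with the constructed one and inherits the decay.  The velocity \<open>A p\<close> is bounded in terms of \<open>A\<close> and the Lipschitz constant of
  \<open>u\<close>, so characteristics starting in the ball of radius \<open>R / 2\<close> stay in the ball of radius \<open>R\<close> for a
  time that depends only on \<open>R\<close> and this bound.
\<close>

section \<open>Superdifferentials, right derivatives and cluster functions\<close>

lemma superdifferential_iff:
  fixes u :: "'a::real_inner \<Rightarrow> real"
  shows "P \<in> superdifferential u X \<longleftrightarrow>
    (\<forall>e>0. \<exists>d>0. \<forall>Y. norm (Y - X) < d \<longrightarrow> u Y - u X - P \<bullet> (Y - X) \<le> e * norm (Y - X))"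
  (is "_ \<longleftrightarrow> ?R")
proof
  assume P: "P \<in> superdifferential u X"
  show ?R
  proof (intro allI impI)
    fix e :: real assume e: "e > 0"
    have "Limsup (at X) (\<lambda>Y. ereal ((u Y - u X - P \<bullet> (Y - X)) / norm (Y - X))) < ereal e"
      using P e unfolding superdifferential_def
      by (metis (mono_tags, lifting) ereal_less(2) mem_Collect_eq order_le_less_trans)
    then have "\<forall>\<^sub>F Y in at X. ereal ((u Y - u X - P \<bullet> (Y - X)) / norm (Y - X)) < ereal e"
      by (rule Limsup_lessD)
    then obtain d where d: "d > 0"
      "\<And>Y. Y \<noteq> X \<Longrightarrow> dist Y X < d \<Longrightarrow> (u Y - u X - P \<bullet> (Y - X)) / norm (Y - X) < e"
      unfolding eventually_at by auto
    have "u Y - u X - P \<bullet> (Y - X) \<le> e * norm (Y - X)" if "norm (Y - X) < d" for Y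
    proof (cases "Y = X")
      case False
      then show ?thesis using d(2)[of Y] that by (simp add: dist_norm divide_simps)
    qed simp
    then show "\<exists>d>0. \<forall>Y. norm (Y - X) < d \<longrightarrow> u Y - u X - P \<bullet> (Y - X) \<le> e * norm (Y - X)"
      using d(1) by blast
  qed
next
  assume R: ?R
  have "\<forall>\<^sub>F Y in at X. ereal ((u Y - u X - P \<bullet> (Y - X)) / norm (Y - X)) < y" if y: "0 < y" for y
  proof -
    obtain e where e: "e > 0" "ereal e < y"
      using y by (metis ereal_dense2 ereal_less(2))
    obtain d where d: "d > 0"
      "\<And>Y. norm (Y - X) < d \<Longrightarrow> u Y - u X - P \<bullet> (Y - X) \<le> e * norm (Y - X)"
      using R e(1) by blast
    have "\<forall>\<^sub>F Y in at X. Y \<noteq> X \<and> dist Y X < d"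
      unfolding eventually_at using d(1) by blast
    then show ?thesis
    proof eventually_elim
      case (elim Y)
      then have "(u Y - u X - P \<bullet> (Y - X)) / norm (Y - X) \<le> e"
        using d(2)[of Y] by (simp add: dist_norm divide_simps)
      then show ?case using e(2) by (metis ereal_less_eq(3) order_le_less_trans)
    qed
  qed
  then show "P \<in> superdifferential u X"
    unfolding superdifferential_def Limsup_le_iff by simp
qed

text \<open>
  Moving from \<open>X\<close> in the direction \<open>- P\<close> makes \<open>u\<close> decrease at rate at least \<open>|P|\<close>, and a Lipschitz
  function decreases at rate at most \<open>C\<close>.
\<close>
lemma norm_superdifferential_le:
  fixes u :: "'a::real_inner \<Rightarrow> real"
  assumes lip: "C-lipschitz_on D u" and D: "open D" "X \<in> D" and P: "P \<in> superdifferential u X"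
  shows "norm P \<le> C"
proof (rule field_le_epsilon)
  fix e :: real assume e: "e > 0"
  obtain d where d: "d > 0"
    "\<And>Y. norm (Y - X) < d \<Longrightarrow> u Y - u X - P \<bullet> (Y - X) \<le> e * norm (Y - X)"
    using P e unfolding superdifferential_iff by blast
  obtain r where r: "r > 0" "ball X r \<subseteq> D" using D openE by blast
  show "norm P \<le> C + e"
  proof (cases "P = 0")
    case True
    then show ?thesis using e lipschitz_on_nonneg[OF lip] by simp
  next
    case False
    define s where "s = min d r / (2 * norm P)"
    have s: "s > 0" using False d(1) r(1) by (simp add: s_def)
    have "s * norm P = min d r / 2" using False by (simp add: s_def)
    then have sn: "s * norm P < d" "s * norm P < r" using d(1) r(1) by auto
    define Y where "Y = X - s *\<^sub>R P"
    have n: "norm (Y - X) = s * norm P" using s by (simp add: Y_def)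
    have "Y \<in> D" using r(2) sn n by (auto simp: dist_norm norm_minus_commute)
    then have "\<bar>u Y - u X\<bar> \<le> C * (s * norm P)"
      using lipschitz_onD[OF lip _ D(2)] n by (metis dist_norm real_norm_def)
    moreover have "P \<bullet> (Y - X) = - (s * (norm P)\<^sup>2)"
      by (simp add: Y_def power2_norm_eq_inner)
    ultimately have "s * (norm P)\<^sup>2 \<le> (C + e) * (s * norm P)"
      using d(2)[of Y] n sn by (simp add: algebra_simps)
    then have "(s * norm P) * norm P \<le> (s * norm P) * (C + e)"
      by (simp add: power2_eq_square algebra_simps)
    then show ?thesis using s False by simp
  qed
qed

lemma le_if_le_add_small:
  fixes a b c l0 :: real
  assumes "l0 > 0" and "\<And>l. 0 < l \<Longrightarrow> l < l0 \<Longrightarrow> a \<le> b + l * c"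
  shows "a \<le> b"
proof -
  have "((\<lambda>l. b + l * c) \<longlongrightarrow> b + 0 * c) (at_right 0)"
    by (intro tendsto_intros)
  moreover have "\<forall>\<^sub>F l in at_right 0. a \<le> b + l * c"
    using assms by (auto simp: eventually_at_right_field)
  ultimately show ?thesis
    using tendsto_lowerbound trivial_limit_at_right_real by fastforce
qed

text \<open>
  A one-dimensional Hahn-Banach argument: on the slice \<open>t = t1\<close> the function is nonpositive, so by
  concavity the difference quotients in \<open>t\<close> taken after \<open>t1\<close> lie below those taken before \<open>t1\<close>, and any
  number between them serves as \<open>a\<close>.  It extends a supergradient in \<open>x\<close> alone to one in \<open>(t, x)\<close>.
\<close>
lemma concave_time_slope:
  fixes W :: "real \<times> 'a::real_normed_vector \<Rightarrow> real"
  assumes W: "concave_on D W" and D: "open D" "(t1, x1) \<in> D"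
    and slice: "\<And>x. (t1, x) \<in> D \<Longrightarrow> W (t1, x) \<le> 0"
  shows "\<exists>a. \<forall>(t, x)\<in>D. W (t, x) \<le> a * (t - t1)"
proof -
  obtain r where r: "r > 0" "ball (t1, x1) r \<subseteq> D" using D openE by blast
  have in_D: "(t1 + c, x1) \<in> D" if "\<bar>c\<bar> < r" for c
    using r(2) that by (auto simp: dist_Pair_Pair dist_real_def)
  define E where "E = {W (t, x) / (t - t1) | t x. (t, x) \<in> D \<and> t > t1}"
  have cross: "W (t, x) / (t - t1) \<le> - W (t', x') / (t1 - t')"
    if *: "(t, x) \<in> D" "t > t1" "(t', x') \<in> D" "t' < t1" for t x t' x'
  proof -
    \<comment> \<open>the weight that puts the convex combination on the slice \<open>t = t1\<close>\<close>
    define l where "l = (t1 - t') / (t - t')"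
    have l: "0 \<le> l" "0 \<le> 1 - l" using * by (auto simp: l_def divide_simps)
    have l': "1 - l = (t - t1) / (t - t')" using * by (simp add: l_def divide_simps)
    have tt: "l * t + (1 - l) * t' = t1"
      unfolding l' unfolding l_def using * by (simp add: divide_simps) algebra
    have mem: "l *\<^sub>R (t, x) + (1 - l) *\<^sub>R (t', x') \<in> D"
      using W * l unfolding concave_on_iff by (intro convexD) auto
    have "l * W (t, x) + (1 - l) * W (t', x') \<le> W (l *\<^sub>R (t, x) + (1 - l) *\<^sub>R (t', x'))"
      using W *(1,3) l unfolding concave_on_iff
      by (metis add.commute diff_add_cancel)
    also have "\<dots> \<le> 0"
      using slice mem tt by simp
    finally have "((t1 - t') * W (t, x) + (t - t1) * W (t', x')) / (t - t') \<le> 0"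
      unfolding l' unfolding l_def by (simp add: add_divide_distrib)
    then have "(t1 - t') * W (t, x) + (t - t1) * W (t', x') \<le> 0"
      using * by (simp add: divide_simps split: if_splits)
    then show ?thesis using * by (simp add: divide_simps) (simp add: algebra_simps)
  qed
  have nonempty: "E \<noteq> {}" using in_D[of "r / 2"] r(1) by (auto simp: E_def intro!: exI[of _ "t1 + r / 2"])
  have bdd: "bdd_above E"
    using cross[OF _ _ in_D[of "- (r / 2)"]] r(1) by (auto simp: E_def intro!: bdd_aboveI)
  have "W (t, x) \<le> Sup E * (t - t1)" if "(t, x) \<in> D" for t x
  proof -
    consider "t > t1" | "t = t1" | "t < t1" by linarith
    then show ?thesis
    proof cases
      case 1
      then have "W (t, x) / (t - t1) \<le> Sup E"
        using that bdd by (auto simp: E_def intro!: cSup_upper)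
      then show ?thesis using 1 by (simp add: divide_simps)
    next
      case 2
      then show ?thesis using slice that by simp
    next
      case 3
      have "Sup E \<le> - W (t, x) / (t1 - t)"
        using nonempty by (rule cSup_least) (use cross that 3 in \<open>auto simp: E_def\<close>)
      then show ?thesis using 3 by (simp add: divide_simps) (simp add: algebra_simps)
    qed
  qed
  then show ?thesis by blast
qed

text \<open>
  Tychonoff's theorem makes the set of all functions into \<open>C\<close> compact, so the sequence has a cluster
  point in the product topology; its neighbourhoods control finitely many arguments at once, and two
  suffice below.  The functions may be step functions, as the polygons below are.
\<close>
lemma pointwise_cluster_function:
  fixes f :: "nat \<Rightarrow> 'a \<Rightarrow> 'b::metric_space"
  assumes C: "compact C" and f: "\<And>n s. f n s \<in> C"
  obtains x where "\<And>s. x s \<in> C"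
    and "\<And>s1 s2 e N. e > 0 \<Longrightarrow> \<exists>n\<ge>N. dist (f n s1) (x s1) < e \<and> dist (f n s2) (x s2) < e"
proof -
  let ?U = "PiE UNIV (\<lambda>_::'a. C)"
  have "compactin (product_topology (\<lambda>_. euclidean) UNIV) ?U"
    unfolding compactin_PiE using C by simp
  then have U: "compact ?U"
    by (simp only: euclidean_product_topology compactin_euclidean_iff)
  define F where "F = filtermap f sequentially"
  have "F \<noteq> bot" "eventually (\<lambda>g. g \<in> ?U) F"
    using f by (auto simp: F_def eventually_filtermap filtermap_bot_iff PiE_iff)
  then obtain x where x: "x \<in> ?U" "inf (nhds x) F \<noteq> bot"
    using U unfolding compact_filter by blast
  have "\<exists>n\<ge>N. dist (f n s1) (x s1) < e \<and> dist (f n s2) (x s2) < e" if e: "e > 0" for s1 s2 e N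
  proof (rule ccontr)
    assume none: "\<not> ?thesis"
    let ?O = "{g. dist (g s1) (x s1) < e} \<inter> {g. dist (g s2) (x s2) < e}"
    have "open ?O"
      by (intro open_Int open_Collect_less continuous_intros
            continuous_on_product_coordinates)
    then have "eventually (\<lambda>g. g \<in> ?O) (nhds x)"
      using e by (intro eventually_nhds_in_open) auto
    moreover have "eventually (\<lambda>g. g \<notin> ?O) F"
      unfolding F_def eventually_filtermap eventually_sequentially using none by auto
    ultimately have "eventually (\<lambda>_. False) (inf (nhds x) F)"
      unfolding eventually_inf by blast
    then show False using x(2) by (simp add: trivial_limit_def)
  qed
  moreover have "x s \<in> C" for s using x(1) by (auto simp: PiE_iff)
  ultimately show thesis using that by blast
qed

text \<open>
  Only a one-sided derivative is available for characteristics.  For each \<open>e > 0\<close> the bound with slope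
  \<open>M + e\<close> holds on a closed set of times that cannot have a last element before \<open>b\<close>.
\<close>
lemma right_derivative_le_imp_increment_le:
  fixes f :: "real \<Rightarrow> real"
  assumes ab: "a \<le> b" and cont: "continuous_on {a..b} f"
    and deriv: "\<And>s. a \<le> s \<Longrightarrow> s < b \<Longrightarrow> \<exists>D\<le>M. (f has_real_derivative D) (at_right s)"
  shows "f b - f a \<le> M * (b - a)"
proof (rule le_if_le_add_small[of 1])
  fix e :: real assume e: "0 < e"
  define Z where "Z = {s \<in> {a..b}. f s - f a - (M + e) * (s - a) \<le> 0}"
  have "closed Z"
    unfolding Z_def
    by (intro continuous_on_closed_Collect_le continuous_intros cont)
  have ne: "a \<in> Z" and bdd: "bdd_above Z" using ab by (auto simp: Z_def)
  define m where "m = Sup Z"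
  have mZ: "m \<in> Z" unfolding m_def using \<open>closed Z\<close> ne bdd by (intro closed_contains_Sup) auto
  have "m = b"
  proof (rule ccontr)
    assume "m \<noteq> b"
    then have m: "a \<le> m" "m < b" using mZ by (auto simp: Z_def)
    then obtain D where D: "D \<le> M" "(f has_real_derivative D) (at_right m)"
      using deriv by blast
    have "((\<lambda>s. (f s - f m) / (s - m)) \<longlongrightarrow> D) (at_right m)"
      using D(2) by (simp add: has_field_derivative_iff)
    then have "\<forall>\<^sub>F s in at_right m. (f s - f m) / (s - m) < M + e"
      using D(1) e by (intro order_tendstoD) auto
    moreover have "\<forall>\<^sub>F s in at_right m. s \<in> {m<..<b}"
      using m by (intro eventually_at_right_real)
    ultimately have "\<forall>\<^sub>F s in at_right m. s \<in> {m<..<b} \<and> (f s - f m) / (s - m) < M + e"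
      by eventually_elim blast
    then obtain s where s: "m < s" "s < b" "(f s - f m) / (s - m) < M + e"
      using eventually_happens'[OF trivial_limit_at_right_real] by fastforce
    have "f s - f m \<le> (M + e) * (s - m)" using s by (simp add: divide_simps)
    then have "s \<in> Z" using mZ s m by (auto simp: Z_def algebra_simps)
    then have "s \<le> m" unfolding m_def using bdd by (intro cSup_upper)
    then show False using s by simp
  qed
  then show "f b - f a \<le> M * (b - a) + e * (b - a)"
    using mZ by (simp add: Z_def algebra_simps)
qed simp

lemma norm_increment_le_of_right_derivative:
  fixes x :: "real \<Rightarrow> 'a::real_inner"
  assumes ab: "a \<le> b" and cont: "continuous_on {a..b} x"
    and deriv: "\<And>s. a \<le> s \<Longrightarrow> s < b \<Longrightarrow> \<exists>v. norm v \<le> M \<and> (x has_vector_derivative v) (at_right s)"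
  shows "norm (x b - x a) \<le> M * (b - a)"
proof (cases "x b = x a")
  case True
  show ?thesis
  proof (cases "a = b")
    case False
    then obtain v :: 'a where "norm v \<le> M" using deriv[of a] ab by auto
    then have "0 \<le> M" using norm_ge_zero order_trans by blast
    then show ?thesis using True ab by simp
  qed simp
next
  case False
  define e where "e = sgn (x b - x a)"
  have e: "norm e = 1" using False by (simp add: e_def norm_sgn)
  have "x b \<bullet> e - x a \<bullet> e \<le> M * (b - a)"
  proof (rule right_derivative_le_imp_increment_le[OF ab])
    show "continuous_on {a..b} (\<lambda>s. x s \<bullet> e)" by (intro continuous_intros cont)
    fix s assume "a \<le> s" "s < b"
    then obtain v where v: "norm v \<le> M" "(x has_vector_derivative v) (at_right s)"
      using deriv by blast
    have "((\<lambda>s. x s \<bullet> e) has_real_derivative v \<bullet> e) (at_right s)"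
      using bounded_linear.has_vector_derivative[OF bounded_linear_inner_left v(2), of e]
      by (simp add: has_real_derivative_iff_has_vector_derivative)
    moreover have "v \<bullet> e \<le> M" using norm_cauchy_schwarz[of v e] v(1) e by simp
    ultimately show "\<exists>D\<le>M. ((\<lambda>s. x s \<bullet> e) has_real_derivative D) (at_right s)" by blast
  qed
  moreover have "x b \<bullet> e - x a \<bullet> e = norm (x b - x a)"
  proof -
    have "x b \<bullet> e - x a \<bullet> e = (x b - x a) \<bullet> e" by (simp add: inner_diff_left)
    also have "\<dots> = (x b - x a) \<bullet> (x b - x a) / norm (x b - x a)"
      by (simp only: e_def sgn_div_norm inner_scaleR_right) (simp add: divide_inverse mult.commute)
    finally have "x b \<bullet> e - x a \<bullet> e = (x b - x a) \<bullet> (x b - x a) / norm (x b - x a)" .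
    then show ?thesis using False by (simp add: power2_norm_eq_inner[symmetric] power2_eq_square)
  qed
  ultimately show ?thesis by simp
qed

section \<open>The inverse of a positive definite matrix\<close>

lemma sym_pos_def_inverse:
  assumes A: "sym_pos_def A"
  shows "A *v (matrix_inv A *v q) = q" and "matrix_inv A *v (A *v q) = q"
    and "(matrix_inv A *v q) \<bullet> r = q \<bullet> (matrix_inv A *v r)"
proof -
  have "x = 0" if "A *v x = 0" for x
    using A that unfolding sym_pos_def_def by (metis inner_zero_left less_irrefl)
  then have "invertible A"
    using matrix_left_invertible_ker invertible_left_inverse by blast
  then have inv: "A ** matrix_inv A = mat 1" "matrix_inv A ** A = mat 1"
    unfolding invertible_def matrix_inv_def by (metis (mono_tags, lifting) someI_ex)+
  show 1: "A *v (matrix_inv A *v q) = q" for q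
    by (simp add: matrix_vector_mul_assoc inv)
  show "matrix_inv A *v (A *v q) = q"
    by (simp add: matrix_vector_mul_assoc inv)
  have "(A *v x) \<bullet> y = x \<bullet> (A *v y)" for x y
    using A unfolding sym_pos_def_def by (metis dot_lmul_matrix vector_transpose_matrix)
  then show "(matrix_inv A *v q) \<bullet> r = q \<bullet> (matrix_inv A *v r)"
    by (metis 1)
qed

lemma sym_pos_def_inverse_coercive:
  assumes A: "sym_pos_def A"
  obtains c where "c > 0" and "\<And>q. c * (norm q)\<^sup>2 \<le> (matrix_inv A *v q) \<bullet> q"
proof -
  let ?f = "\<lambda>q. (matrix_inv A *v q) \<bullet> q"
  have pos: "?f q > 0" if "q \<noteq> 0" for q
    using A that sym_pos_def_inverse[OF A] unfolding sym_pos_def_def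
    by (metis inner_commute matrix_vector_mult_0_right)
  have "continuous_on (sphere 0 1) ?f"
    by (intro continuous_intros matrix_vector_mult_linear_continuous_on)
  then obtain x where x: "x \<in> sphere 0 1" "\<And>y. y \<in> sphere 0 1 \<Longrightarrow> ?f x \<le> ?f y"
    using continuous_attains_inf[OF compact_sphere, of 0 1 ?f] by auto
  have "?f x * (norm q)\<^sup>2 \<le> ?f q" for q
  proof (cases "q = 0")
    case False
    have "?f x \<le> ?f (q /\<^sub>R norm q)" using x(2)[of "q /\<^sub>R norm q"] False by simp
    then show ?thesis using False
      by (simp add: matrix_vector_mult_scaleR power2_eq_square divide_simps mult.assoc)
  qed simp
  then show thesis using that[of "?f x"] pos[of x] x(1) by fastforce
qed

section \<open>Semiconcavity from the Hopf formula\<close>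

text \<open>
  The open convex set \<open>D\<close> stands for the part of a ball after time \<open>tbar\<close>, and \<open>g\<close> for the values of \<open>u\<close>
  at time \<open>tbar\<close>; the number \<open>c\<close> is a lower bound for the eigenvalues of the inverse of \<open>A\<close>.
\<close>

locale hopf_region =
  fixes A :: "real^'n^'n"
    and D :: "(real \<times> (real^'n)) set"
    and u :: "real \<times> (real^'n) \<Rightarrow> real"
    and g :: "real^'n \<Rightarrow> real" and \<Omega> :: "(real^'n) set"
    and tbar C c :: real
  assumes spd: "sym_pos_def A"
    and open_D: "open D" and convex_D: "convex D" and after: "\<And>X. X \<in> D \<Longrightarrow> tbar < fst X"
    and lip: "C-lipschitz_on D u"
    and hopf: "\<And>t x. (t, x) \<in> D \<Longrightarrow>
       has_min (\<lambda>y. (t - tbar) * lagrangian A ((x - y) /\<^sub>R (t - tbar)) + g y) \<Omega> (u (t, x))"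
    and c_pos: "c > 0" and coercive: "\<And>q. c * (norm q)\<^sup>2 \<le> (matrix_inv A *v q) \<bullet> q"
begin

abbreviation "B \<equiv> matrix_inv A"

abbreviation "L \<equiv> lagrangian A"

abbreviation "F \<equiv> full_hamiltonian A"

definition age :: "real \<times> (real^'n) \<Rightarrow> real" where "age X = fst X - tbar"

lemmas AB = sym_pos_def_inverse(1)[OF spd] and BA = sym_pos_def_inverse(2)[OF spd]
  and B_sym = sym_pos_def_inverse(3)[OF spd]

lemma age_pos: "X \<in> D \<Longrightarrow> 0 < age X"
  using after by (auto simp: age_def)

lemma fst_diff_age: "fst Y - fst X = age Y - age X"
  by (simp add: age_def)

lemma age_less_iff: "age X < age Y \<longleftrightarrow> fst X < fst Y"
  by (simp add: age_def)

lemma C_nonneg: "C \<ge> 0"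
  using lip lipschitz_on_nonneg by blast

lemma L_scale: "L (a *\<^sub>R q) = a\<^sup>2 * L q"
  by (simp add: lagrangian_def matrix_vector_mult_scaleR power2_eq_square)

lemma L_add: "L (q + r) = L q + (B *v q) \<bullet> r + L r"
  using B_sym[of q r]
  by (simp add: lagrangian_def matrix_vector_mult_add_rdistrib inner_add_left inner_add_right
      inner_commute matrix_vector_right_distrib algebra_simps)

lemma L_diff: "L (q - r) = L q - (B *v q) \<bullet> r + L r"
  using L_add[of q "-r"] L_scale[of "-1" r] by simp

lemma L_velocity: "L (h *\<^sub>R (A *v p)) = h\<^sup>2 * hamiltonian A p"
  unfolding L_scale by (simp add: lagrangian_def hamiltonian_def BA inner_commute)

lemma L_ge: "c / 2 * (norm q)\<^sup>2 \<le> L q"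
  using coercive[of q] by (simp add: lagrangian_def)

lemma L_nonneg: "L q \<ge> 0"
  using L_ge[of q] c_pos by (smt (verit) mult_nonneg_nonneg divide_nonneg_nonneg zero_le_power2)

lemma L_0 [simp]: "L 0 = 0"
  using L_scale[of 0 0] by simp

lemma L_le: "L q \<le> onorm ((*v) B) / 2 * (norm q)\<^sup>2"
proof -
  have "(B *v q) \<bullet> q \<le> norm (B *v q) * norm q" by (rule norm_cauchy_schwarz)
  also have "\<dots> \<le> (onorm ((*v) B) * norm q) * norm q"
    by (intro mult_right_mono onorm matrix_vector_mul_bounded_linear) auto
  finally show ?thesis by (simp add: lagrangian_def power2_eq_square)
qed

lemma continuous_L [continuous_intros]: "continuous_on S f \<Longrightarrow> continuous_on S (\<lambda>x. L (f x))"
  unfolding lagrangian_def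
  by (intro continuous_intros bounded_linear.continuous_on[OF matrix_vector_mul_bounded_linear])

lemma velocity_bound: "norm (A *v p) \<le> norm p / c"
proof (cases "A *v p = 0")
  case False
  have "c * (norm (A *v p))\<^sup>2 \<le> p \<bullet> (A *v p)" using coercive[of "A *v p"] by (simp add: BA)
  also have "\<dots> \<le> norm p * norm (A *v p)" by (rule norm_cauchy_schwarz)
  finally have "c * norm (A *v p) \<le> norm p"
    using False by (simp add: power2_eq_square mult.assoc[symmetric])
  then show ?thesis using c_pos by (simp add: field_simps)
qed (use c_pos in simp)

lemma hopf_le: "X \<in> D \<Longrightarrow> y \<in> \<Omega> \<Longrightarrow> age X * u X \<le> L (snd X - y) + age X * g y"
  and hopf_ex: "X \<in> D \<Longrightarrow> \<exists>y\<in>\<Omega>. age X * u X = L (snd X - y) + age X * g y"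
proof -
  assume X: "X \<in> D"
  have *: "age X * (age X * L ((snd X - y) /\<^sub>R age X) + g y) = L (snd X - y) + age X * g y" for y
  proof -
    have "age X * age X * (inverse (age X))\<^sup>2 = 1"
      using age_pos[OF X] by (simp add: power2_eq_square field_simps)
    then have "age X * (age X * ((inverse (age X))\<^sup>2 * r)) = r" for r
      by (simp add: mult.assoc[symmetric])
    then show ?thesis by (simp add: L_scale distrib_left)
  qed
  have m: "has_min (\<lambda>y. age X * L ((snd X - y) /\<^sub>R age X) + g y) \<Omega> (u X)"
    using hopf[of "fst X" "snd X"] X by (simp add: age_def)
  show "age X * u X \<le> L (snd X - y) + age X * g y" if "y \<in> \<Omega>"
    using m that age_pos[OF X] unfolding has_min_def
    by (metis "*" mult_left_mono less_eq_real_def)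
  show "\<exists>y\<in>\<Omega>. age X * u X = L (snd X - y) + age X * g y"
    using m unfolding has_min_def using * by metis
qed

lemma age_convex: "age ((1 - l) *\<^sub>R X + l *\<^sub>R Y) = (1 - l) * age X + l * age Y"
  by (simp add: age_def algebra_simps)

text \<open>
  The point \<open>y\<close> that attains the minimum at the intermediate point is admissible at both end points.
  The functions \<open>L (x - y) + \<tau> g y\<close> differ from affine ones only by the quadratic form \<open>L\<close>, whose second
  difference is the error term.
\<close>
lemma semiconcave:
  assumes X: "X \<in> D" and Y: "Y \<in> D" and l: "0 \<le> l" "l \<le> 1"
  shows "(1 - l) * (age X * u X) + l * (age Y * u Y) \<le>
     age ((1 - l) *\<^sub>R X + l *\<^sub>R Y) * u ((1 - l) *\<^sub>R X + l *\<^sub>R Y) + l * (1 - l) * L (snd Y - snd X)"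
proof -
  let ?Z = "(1 - l) *\<^sub>R X + l *\<^sub>R Y"
  have Z: "?Z \<in> D" using convexD[OF convex_D X Y, of "1 - l" l] l by simp
  obtain y where y: "y \<in> \<Omega>" "age ?Z * u ?Z = L (snd ?Z - y) + age ?Z * g y"
    using hopf_ex[OF Z] by blast
  let ?q = "snd X - y" and ?d = "snd Y - snd X"
  have "snd Y - y = ?q + ?d" by simp
  then have LY: "L (snd Y - y) = L ?q + (B *v ?q) \<bullet> ?d + L ?d" using L_add by metis
  have "snd ?Z - y = ?q + l *\<^sub>R ?d" by (simp add: algebra_simps)
  then have LZ: "L (snd ?Z - y) = L ?q + l * ((B *v ?q) \<bullet> ?d) + l\<^sup>2 * L ?d"
    by (simp only: L_add L_scale inner_scaleR_right)
  have "(1 - l) * (age X * u X) \<le> (1 - l) * (L ?q + age X * g y)"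
    using hopf_le[OF X y(1)] l by (intro mult_left_mono) auto
  moreover have "l * (age Y * u Y) \<le> l * (L (snd Y - y) + age Y * g y)"
    using hopf_le[OF Y y(1)] l by (intro mult_left_mono) auto
  ultimately have "(1 - l) * (age X * u X) + l * (age Y * u Y) \<le>
      (1 - l) * (L ?q + age X * g y) + l * (L (snd Y - y) + age Y * g y)"
    by (rule add_mono)
  also have "\<dots> = (L (snd ?Z - y) + age ?Z * g y) + l * (1 - l) * L ?d"
    unfolding LZ LY age_convex by algebra
  finally show ?thesis unfolding y(2) .
qed

text \<open>
  The global form of the superdifferential: with \<open>X = (t, x)\<close>, the condition says that
  \<open>(u X, - B x) + \<tau> P\<close> is a supergradient at \<open>X\<close> of the concave function \<open>\<tau> u - L(x)\<close>.
\<close>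
definition supergradients :: "real \<times> (real^'n) \<Rightarrow> (real \<times> (real^'n)) set" where
  "supergradients X =
     {P. \<forall>Y\<in>D. age Y * (u Y - u X) \<le> age X * (P \<bullet> (Y - X)) + L (snd Y - snd X)}"

lemma supergradientsD:
  "P \<in> supergradients X \<Longrightarrow> Y \<in> D \<Longrightarrow>
     age Y * (u Y - u X) \<le> age X * (P \<bullet> (Y - X)) + L (snd Y - snd X)"
  by (simp add: supergradients_def)

text \<open>
  For a concave function an upper bound near \<open>X\<close> on a segment propagates to the whole segment.  The
  second-order term \<open>l\<^sup>2 * b\<close> disappears as \<open>l\<close> tends to \<open>0\<close>; it accommodates the quadratic penalty of a
  proximal step.
\<close>
lemma local_bound_imp_supergradient:
  assumes X: "X \<in> D" and Y: "Y \<in> D" and d: "d > 0"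
    and loc: "\<And>l. 0 < l \<Longrightarrow> l < d \<Longrightarrow> u (X + l *\<^sub>R (Y - X)) - u X \<le> l * a + l\<^sup>2 * b"
  shows "age Y * (u Y - u X) \<le> age X * a + L (snd Y - snd X)"
proof -
  let ?d = "L (snd Y - snd X)"
  define m where "m = (age Y - age X) * b"
  define k where "k = (age Y - age X) * a + age X * b - ?d"
  have "age Y * (u Y - u X) \<le> age X * a + ?d + l * (k + \<bar>m\<bar>)"
    if l: "0 < l" "l < min d 1" for l
  proof -
    let ?Z = "(1 - l) *\<^sub>R X + l *\<^sub>R Y"
    have Z: "?Z = X + l *\<^sub>R (Y - X)" by (simp add: algebra_simps)
    have "?Z \<in> D" using convexD[OF convex_D X Y, of "1 - l" l] l by simp
    then have ap: "age ?Z > 0" by (rule age_pos)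
    have "(1 - l) * (age X * u X) + l * (age Y * u Y) \<le> age ?Z * u ?Z + l * (1 - l) * ?d"
      using semiconcave[OF X Y] l by simp
    also have "age ?Z * u ?Z \<le> age ?Z * (u X + l * a + l\<^sup>2 * b)"
      using loc[of l] l ap unfolding Z by (intro mult_left_mono) auto
    finally have "l * (age Y * (u Y - u X)) \<le> l * (age X * a + ?d + l * (k + l * m))"
      unfolding age_convex k_def m_def by (simp add: algebra_simps power2_eq_square)
    then have *: "age Y * (u Y - u X) \<le> age X * a + ?d + l * (k + l * m)"
      using l(1) by (simp only: mult_le_cancel_left_pos)
    have "l * m \<le> l * \<bar>m\<bar>" using l by (intro mult_left_mono) auto
    also have "\<dots> \<le> 1 * \<bar>m\<bar>" using l by (intro mult_right_mono) auto
    finally have "l * (k + l * m) \<le> l * (k + \<bar>m\<bar>)" using l by (intro mult_left_mono) auto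
    then show ?thesis using * by linarith
  qed
  moreover have "min d 1 > 0" using d by simp
  ultimately show ?thesis by (rule le_if_le_add_small[rotated])
qed

lemma superdifferential_eq_supergradients:
  assumes X: "X \<in> D"
  shows "superdifferential u X = supergradients X"
proof (intro set_eqI iffI)
  fix P assume P: "P \<in> superdifferential u X"
  have "age Y * (u Y - u X) \<le> age X * (P \<bullet> (Y - X)) + L (snd Y - snd X)" if Y: "Y \<in> D" for Y
  proof (cases "Y = X")
    case False
    have "age Y * (u Y - u X) \<le>
        age X * (P \<bullet> (Y - X)) + L (snd Y - snd X) + e * (age X * norm (Y - X))"
      if e: "e > 0" for e
    proof -
      obtain d where d: "d > 0"
        "\<And>Y. norm (Y - X) < d \<Longrightarrow> u Y - u X - P \<bullet> (Y - X) \<le> e * norm (Y - X)"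
        using P e unfolding superdifferential_iff by blast
      have "age Y * (u Y - u X) \<le>
          age X * (P \<bullet> (Y - X) + e * norm (Y - X)) + L (snd Y - snd X)"
      proof (rule local_bound_imp_supergradient[OF X Y, where d = "d / norm (Y - X)" and b = 0])
        show "d / norm (Y - X) > 0" using d(1) False by simp
        fix l assume l: "0 < l" "l < d / norm (Y - X)"
        define Z where "Z = X + l *\<^sub>R (Y - X)"
        have n: "norm (Z - X) = l * norm (Y - X)" and P: "P \<bullet> (Z - X) = l * (P \<bullet> (Y - X))"
          using l by (simp_all add: Z_def)
        have "norm (Z - X) < d" unfolding n using l(2) False by (simp add: pos_less_divide_eq)
        from d(2)[OF this] have "u Z - u X \<le> l * (P \<bullet> (Y - X)) + e * (l * norm (Y - X))"
          unfolding n P by simp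
        then show "u (X + l *\<^sub>R (Y - X)) - u X \<le> l * (P \<bullet> (Y - X) + e * norm (Y - X)) + l\<^sup>2 * 0"
          by (simp add: Z_def[symmetric] distrib_left mult.left_commute)
      qed
      then show ?thesis by (simp add: algebra_simps)
    qed
    then show ?thesis
      using le_if_le_add_small[of 1 "age Y * (u Y - u X)"
          "age X * (P \<bullet> (Y - X)) + L (snd Y - snd X)" "age X * norm (Y - X)"] by simp
  qed simp
  then show "P \<in> supergradients X" by (simp add: supergradients_def)
next
  fix P assume P: "P \<in> supergradients X"
  define M where "M = norm P + onorm ((*v) B) / 2 + 1"
  have M: "M > 0"
    unfolding M_def
    using onorm_pos_le[OF matrix_vector_mul_bounded_linear, of B]
    by (intro add_nonneg_pos add_nonneg_nonneg) auto
  show "P \<in> superdifferential u X"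
    unfolding superdifferential_iff
  proof (intro allI impI)
    fix e :: real assume e: "e > 0"
    obtain r where r: "r > 0" "ball X r \<subseteq> D" using open_D X openE by blast
    define d where "d = min r (min (age X / 2) (e * age X / 2 / M))"
    have d: "d > 0" using r(1) e M age_pos[OF X] by (simp add: d_def)
    have "u Y - u X - P \<bullet> (Y - X) \<le> e * norm (Y - X)" if Yd: "norm (Y - X) < d" for Y
    proof -
      have Y: "Y \<in> D" using r Yd by (auto simp: d_def dist_norm norm_minus_commute)
      let ?n = "norm (Y - X)"
      have t: "\<bar>fst Y - fst X\<bar> \<le> ?n" and x: "norm (snd Y - snd X) \<le> ?n"
        by (metis fst_diff norm_fst_le prod.collapse real_norm_def)
          (metis norm_snd_le prod.collapse snd_diff)
      have aXY: "\<bar>age X - age Y\<bar> \<le> ?n" using t by (simp add: age_def)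
      moreover have n: "?n < age X / 2" "?n < e * age X / 2 / M" using Yd by (simp_all only: d_def min_less_iff_conj)
      ultimately have aY: "age Y \<ge> age X / 2" by linarith
      have "(age X - age Y) * (P \<bullet> (Y - X)) \<le> \<bar>age X - age Y\<bar> * \<bar>P \<bullet> (Y - X)\<bar>"
        by (metis abs_ge_self abs_mult)
      also have "\<dots> \<le> ?n * (norm P * ?n)"
        using aXY by (intro mult_mono Cauchy_Schwarz_ineq2) auto
      finally have 1: "(age X - age Y) * (P \<bullet> (Y - X)) \<le> norm P * ?n\<^sup>2"
        by (simp add: power2_eq_square algebra_simps)
      have "L (snd Y - snd X) \<le> onorm ((*v) B) / 2 * (norm (snd Y - snd X))\<^sup>2" by (rule L_le)
      also have "\<dots> \<le> onorm ((*v) B) / 2 * ?n\<^sup>2"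
        using x onorm_pos_le[OF matrix_vector_mul_bounded_linear, of B]
        by (intro mult_left_mono power_mono) auto
      finally have 2: "L (snd Y - snd X) \<le> onorm ((*v) B) / 2 * ?n\<^sup>2" .
      have "age Y * (u Y - u X - P \<bullet> (Y - X)) \<le> (age X - age Y) * (P \<bullet> (Y - X)) + L (snd Y - snd X)"
        using supergradientsD[OF P Y] by (simp add: algebra_simps)
      also have "\<dots> \<le> M * ?n\<^sup>2" using 1 2 zero_le_power2[of ?n] by (simp only: distrib_right M_def)
      also have "\<dots> = (M * ?n) * ?n" by (simp add: power2_eq_square)
      also have "\<dots> \<le> (e * age X / 2) * ?n"
      proof (rule mult_right_mono)
        have "?n \<le> e * age X / 2 / M" using n(2) by simp
        then show "M * ?n \<le> e * age X / 2" using M by (simp only: pos_le_divide_eq mult.commute[of M])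
      qed simp
      also have "\<dots> \<le> age Y * (e * ?n)"
        using mult_right_mono[OF aY, of "e * ?n"] e by (simp add: algebra_simps)
      finally show ?thesis using age_pos[OF Y] by simp
    qed
    then show "\<exists>d>0. \<forall>Y. norm (Y - X) < d \<longrightarrow> u Y - u X - P \<bullet> (Y - X) \<le> e * norm (Y - X)"
      using d by blast
  qed
qed

lemma norm_supergradient_le: "X \<in> D \<Longrightarrow> P \<in> supergradients X \<Longrightarrow> norm P \<le> C"
  using norm_superdifferential_le[OF lip open_D] superdifferential_eq_supergradients by blast

text \<open>
  If \<open>y\<close> attains the minimum at \<open>X\<close>, then \<open>\<tau> L((x - y) / \<tau>) + g y\<close> touches \<open>u\<close> from above at \<open>X\<close>, and its
  gradient is a supergradient of \<open>u\<close>.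
\<close>
lemma supergradients_nonempty:
  assumes X: "X \<in> D"
  shows "supergradients X \<noteq> {}"
proof -
  obtain y where y: "y \<in> \<Omega>" "age X * u X = L (snd X - y) + age X * g y"
    using hopf_ex[OF X] by blast
  let ?q = "snd X - y" and ?a = "age X"
  have a: "?a > 0" using X by (rule age_pos)
  let ?P = "(- L ?q / ?a\<^sup>2, (B *v ?q) /\<^sub>R ?a)"
  have "age Y * (u Y - u X) \<le> ?a * (?P \<bullet> (Y - X)) + L (snd Y - snd X)" if Y: "Y \<in> D" for Y
  proof -
    let ?d = "snd Y - snd X"
    have "snd Y - y = ?q + ?d" by simp
    then have LY: "L (snd Y - y) = L ?q + (B *v ?q) \<bullet> ?d + L ?d" using L_add by metis
    have g: "g y = u X - L ?q / ?a" using y(2) a by (simp add: field_simps)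
    have "age Y * u Y \<le> L ?q + (B *v ?q) \<bullet> ?d + L ?d + age Y * (u X - L ?q / ?a)"
      using hopf_le[OF Y y(1)] unfolding LY g .
    then have "age Y * (u Y - u X) \<le> L ?q - age Y * L ?q / ?a + (B *v ?q) \<bullet> ?d + L ?d"
      by (simp add: algebra_simps)
    also have "\<dots> = ?a * (?P \<bullet> (Y - X)) + L ?d"
    proof -
      have P: "?P \<bullet> (Y - X) =
          inverse ?a * ((B *v ?q) \<bullet> ?d) - L ?q * (age Y - ?a) / (?a * ?a)"
        by (simp add: inner_prod_def fst_diff_age power2_eq_square)
      have "?a * (?P \<bullet> (Y - X)) = (B *v ?q) \<bullet> ?d - L ?q * (age Y - ?a) / ?a"
        using a unfolding P by (simp add: divide_simps)
      then show ?thesis using a by (simp add: diff_divide_distrib right_diff_distrib mult.commute)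
    qed
    finally show ?thesis .
  qed
  then have "?P \<in> supergradients X" by (simp add: supergradients_def)
  then show ?thesis by blast
qed

text \<open>
  The weights come from multiplying the inequality of \<open>P\<close> by the age of its own base point \<open>X\<close>, and that
  of \<open>Q\<close> by the age of \<open>Y\<close>: then the values of \<open>u\<close> cancel in the sum.
\<close>
lemma supergradient_monotone:
  assumes X: "X \<in> D" "P \<in> supergradients X" and Y: "Y \<in> D" "Q \<in> supergradients Y"
  shows "(age Y)\<^sup>2 * (Q \<bullet> (Y - X)) - (age X)\<^sup>2 * (P \<bullet> (Y - X)) \<le>
    (age X + age Y) * L (snd Y - snd X)"
proof -
  have "age X * (age Y * (u Y - u X)) \<le> age X * (age X * (P \<bullet> (Y - X)) + L (snd Y - snd X))"
    using supergradientsD[OF X(2) Y(1)] age_pos[OF X(1)] by simp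
  moreover have "age Y * (age X * (u X - u Y)) \<le> age Y * (age Y * (Q \<bullet> (X - Y)) + L (snd X - snd Y))"
    using supergradientsD[OF Y(2) X(1)] age_pos[OF Y(1)] by simp
  moreover have "Q \<bullet> (X - Y) = - (Q \<bullet> (Y - X))" by (simp add: inner_diff_right)
  moreover have "L (snd X - snd Y) = L (snd Y - snd X)"
    using L_scale[of "-1" "snd Y - snd X"] by simp
  ultimately show ?thesis by (simp add: algebra_simps power2_eq_square)
qed

section \<open>Implicit Euler steps\<close>

definition euler_step :: "real \<times> (real^'n) \<Rightarrow> real \<times> (real^'n) \<Rightarrow> bool" where
  "euler_step X Y \<longleftrightarrow> X \<in> D \<and> Y \<in> D \<and> fst X < fst Y \<and>
     (\<exists>P\<in>supergradients Y. snd Y - snd X = (fst Y - fst X) *\<^sub>R (A *v snd P))"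

lemma hamiltonian_polar: "p \<bullet> (A *v q) \<le> hamiltonian A p + hamiltonian A q"
proof -
  have 1: "(A *v p) \<bullet> q = p \<bullet> (A *v q)" using B_sym[of "A *v p" "A *v q"] by (simp add: BA)
  have "0 \<le> L (A *v p - A *v q)" by (rule L_nonneg)
  then show ?thesis
    unfolding L_diff using 1 by (simp add: hamiltonian_def lagrangian_def BA inner_commute)
qed

text \<open>
  For \<open>Y - X = h (1, A q)\<close> the terms of the monotonicity relation are \<open>\<langle>Q, Y - X\<rangle> = h (fst Q + 2 H(q))\<close>,
  \<open>\<langle>P, Y - X\<rangle> = h (fst P + \<langle>p, A q\<rangle>)\<close> and \<open>L(y - x) = h\<^sup>2 H(q)\<close>.  Since \<open>h\<close> is the difference of the ages,
  the right-hand side is \<open>(\<tau>\<^sub>Y\<^sup>2 - \<tau>\<^sub>X\<^sup>2) H(q)\<close>, and \<open>\<langle>p, A q\<rangle> - H(q) \<le> H(p)\<close> concludes.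
\<close>
lemma euler_step_energy:
  assumes X: "X \<in> D" "P \<in> supergradients X" and Y: "Y \<in> D" "Q \<in> supergradients Y"
    and t: "fst X < fst Y" and step: "snd Y - snd X = (fst Y - fst X) *\<^sub>R (A *v snd Q)"
  shows "(age Y)\<^sup>2 * F Q \<le> (age X)\<^sup>2 * F P"
proof -
  let ?HQ = "hamiltonian A (snd Q)"
  define h where "h = fst Y - fst X"
  have h: "h > 0" "h = age Y - age X" using t by (simp_all add: h_def age_def)
  have Q: "Q \<bullet> (Y - X) = h * (fst Q + 2 * ?HQ)"
    by (simp add: inner_prod_def step hamiltonian_def inner_commute distrib_left mult.commute flip: h_def)
  have P: "P \<bullet> (Y - X) = h * (fst P + snd P \<bullet> (A *v snd Q))"
    by (simp add: inner_prod_def step distrib_left mult.commute flip: h_def)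
  have "h * ((age Y)\<^sup>2 * (fst Q + 2 * ?HQ) - (age X)\<^sup>2 * (fst P + snd P \<bullet> (A *v snd Q))) \<le>
      h * ((age X + age Y) * h * ?HQ)"
    using supergradient_monotone[OF X Y] unfolding Q P step L_velocity h_def[symmetric]
    by (simp only: power2_eq_square right_diff_distrib ac_simps)
  then have "(age Y)\<^sup>2 * (fst Q + 2 * ?HQ) - (age X)\<^sup>2 * (fst P + snd P \<bullet> (A *v snd Q)) \<le>
      (age X + age Y) * h * ?HQ"
    using h(1) by (simp only: mult_le_cancel_left_pos)
  then have "(age Y)\<^sup>2 * F Q \<le> (age X)\<^sup>2 * (fst P + (snd P \<bullet> (A *v snd Q) - ?HQ))"
    by (simp add: full_hamiltonian_def h(2) algebra_simps power2_eq_square)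
  also have "\<dots> \<le> (age X)\<^sup>2 * F P"
    using hamiltonian_polar[of "snd P" "snd Q"]
    by (intro mult_left_mono) (auto simp: full_hamiltonian_def)
  finally show ?thesis .
qed

lemma supergradient_one_sided_lipschitz:
  assumes X: "X \<in> D" "P \<in> supergradients X" and Y: "Y \<in> D" "Q \<in> supergradients Y"
    and t: "fst X = fst Y"
  shows "age X * ((snd Q - snd P) \<bullet> (snd Y - snd X)) \<le> 2 * L (snd Y - snd X)"
proof -
  have "age X * (age X * ((snd Q - snd P) \<bullet> (snd Y - snd X))) \<le> age X * (2 * L (snd Y - snd X))"
    using supergradient_monotone[OF X Y] t
    by (simp add: age_def inner_prod_def inner_diff_left power2_eq_square algebra_simps)
  then show ?thesis using age_pos[OF X(1)] by simp
qed

text \<open>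
  With \<open>d\<close>, \<open>d\<^sub>1\<close> the differences before and after the step, \<open>B d\<^sub>1 = B d + h (q - p)\<close>.  Testing with \<open>d\<^sub>1\<close>
  and inserting the one-sided Lipschitz bound gives \<open>2 \<tau> L(d\<^sub>1) \<le> \<tau>\<^sub>1 \<langle>B d, d\<^sub>1\<rangle>\<close>; the claim follows from
  \<open>L(\<tau>\<^sub>1 d - \<tau> d\<^sub>1) \<ge> 0\<close>, which plays the role of the Cauchy-Schwarz inequality.
\<close>
lemma euler_step_nonexpansive:
  assumes 1: "euler_step X X1" and 2: "euler_step Y Y1" and t: "fst X = fst Y" "fst X1 = fst Y1"
  shows "L (snd Y1 - snd X1) / (age X1)\<^sup>2 \<le> L (snd Y - snd X) / (age X)\<^sup>2"
proof -
  obtain P where P: "X \<in> D" "X1 \<in> D" "fst X < fst X1" "P \<in> supergradients X1"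
      "snd X1 - snd X = (fst X1 - fst X) *\<^sub>R (A *v snd P)"
    using 1 unfolding euler_step_def by blast
  obtain Q where Q: "Y1 \<in> D" "Q \<in> supergradients Y1"
      "snd Y1 - snd Y = (fst Y1 - fst Y) *\<^sub>R (A *v snd Q)"
    using 2 unfolding euler_step_def by blast
  define d d1 h where "d = snd Y - snd X" and "d1 = snd Y1 - snd X1" and "h = fst X1 - fst X"
  define a a1 where "a = age X" and "a1 = age X1"
  have a: "a > 0" "a1 > 0" "h > 0" "h = a1 - a"
    using age_pos P(1-3) by (auto simp: a_def a1_def h_def fst_diff_age age_less_iff)
  have "d1 - d = (snd Y1 - snd Y) - (snd X1 - snd X)" by (simp add: d_def d1_def)
  also have "\<dots> = h *\<^sub>R (A *v (snd Q - snd P))"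
    unfolding P(5) Q(3) using t by (simp add: h_def scaleR_diff_right matrix_vector_mult_diff_distrib)
  finally have "B *v (d1 - d) = h *\<^sub>R (snd Q - snd P)" by (simp add: matrix_vector_mult_scaleR BA)
  then have "B *v d1 = B *v d + h *\<^sub>R (snd Q - snd P)" by (simp add: matrix_vector_mult_diff_distrib algebra_simps)
  then have "2 * L d1 = (B *v d) \<bullet> d1 + h * ((snd Q - snd P) \<bullet> d1)"
    by (simp add: lagrangian_def inner_add_left)
  then have "a1 * (2 * L d1) = a1 * ((B *v d) \<bullet> d1) + h * (a1 * ((snd Q - snd P) \<bullet> d1))"
    by algebra
  also have "\<dots> \<le> a1 * ((B *v d) \<bullet> d1) + h * (2 * L d1)"
    using supergradient_one_sided_lipschitz[OF P(2,4) Q(1,2) t(2)] a(3)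
    unfolding a1_def d1_def by simp
  finally have 1: "2 * a * L d1 \<le> a1 * ((B *v d) \<bullet> d1)" unfolding a(4) by (simp add: algebra_simps)
  have "0 \<le> L (a1 *\<^sub>R d - a *\<^sub>R d1)" by (rule L_nonneg)
  also have "\<dots> = a1\<^sup>2 * L d - a * (a1 * ((B *v d) \<bullet> d1)) + a\<^sup>2 * L d1"
    by (simp add: L_diff L_scale matrix_vector_mult_scaleR)
  also have "\<dots> \<le> a1\<^sup>2 * L d - a * (2 * a * L d1) + a\<^sup>2 * L d1"
    using mult_left_mono[OF 1, of a] a by simp
  finally have "a\<^sup>2 * L d1 \<le> a1\<^sup>2 * L d" by (simp add: power2_eq_square)
  then have "L d1 / a1\<^sup>2 \<le> L d / a\<^sup>2"
    using a(1,2) by (simp add: pos_divide_le_eq pos_le_divide_eq mult.commute)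
  then show ?thesis by (simp add: d_def d1_def a_def a1_def)
qed

text \<open>
  Velocities \<open>A p\<close> with \<open>|p| \<le> C\<close> are bounded by \<open>C / c\<close>.  The factor \<open>2\<close> is there for the maximizer in
  \<open>euler_step_exists\<close>, which is located by a cruder energy comparison.
\<close>
definition speed :: real where "speed = 2 * C / c"

lemma speed_nonneg: "speed \<ge> 0"
  using C_nonneg c_pos by (simp add: speed_def)

lemma velocity_le_speed: "norm p \<le> C \<Longrightarrow> norm (A *v p) \<le> speed"
proof -
  assume "norm p \<le> C"
  then have "norm (A *v p) \<le> C / c"
    using velocity_bound[of p] c_pos divide_right_mono[of "norm p" C c] by linarith
  also have "\<dots> \<le> speed" using C_nonneg c_pos by (simp add: speed_def divide_right_mono)
  finally show ?thesis .
qed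

lemma supergradient_velocity_le:
  assumes "X \<in> D" "P \<in> supergradients X"
  shows "norm (A *v snd P) \<le> speed"
proof (rule velocity_le_speed)
  show "norm (snd P) \<le> C"
    using norm_supergradient_le[OF assms] norm_snd_le[of "snd P" "fst P"] by simp
qed

lemma continuous_u: "continuous_on D u"
  using lip by (rule lipschitz_on_continuous_on)

lemma supergradient_defect_concave:
  "concave_on D (\<lambda>Y. age Y * (u Y - u X) - a * (p \<bullet> (snd Y - snd X)) - L (snd Y - snd X))"
  (is "concave_on D ?W")
  unfolding concave_on_iff
proof (intro conjI ballI allI impI convex_D)
  fix Y Z and v l :: real
  assume *: "Y \<in> D" "Z \<in> D" "0 \<le> v" "0 \<le> l" "v + l = 1"
  then have v: "v = 1 - l" by simp
  let ?q = "snd Y - snd X" and ?d = "snd Z - snd Y" and ?V = "(1 - l) *\<^sub>R Y + l *\<^sub>R Z"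
  have LZ: "L (snd Z - snd X) = L ?q + (B *v ?q) \<bullet> ?d + L ?d"
    using L_add[of ?q ?d] by simp
  have V: "snd ?V - snd X = ?q + l *\<^sub>R ?d" by (simp add: algebra_simps)
  have LV: "L (snd ?V - snd X) = L ?q + l * ((B *v ?q) \<bullet> ?d) + l\<^sup>2 * L ?d"
    unfolding V by (simp only: L_add L_scale inner_scaleR_right)
  have pZ: "p \<bullet> (snd Z - snd X) = p \<bullet> ?q + p \<bullet> ?d" by (simp add: inner_diff_right)
  have pV: "p \<bullet> (snd ?V - snd X) = p \<bullet> ?q + l * (p \<bullet> ?d)" unfolding V by (simp add: inner_add_right)
  have "(1 - l) * (age Y * u Y) + l * (age Z * u Z) \<le> age ?V * u ?V + l * (1 - l) * L ?d"
    using semiconcave[of Y Z l] * by simp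
  moreover have "v * ?W Y + l * ?W Z =
      ((1 - l) * (age Y * u Y) + l * (age Z * u Z)) - l * (1 - l) * L ?d
      - age ?V * u X - a * (p \<bullet> ?q + l * (p \<bullet> ?d)) - (L ?q + l * ((B *v ?q) \<bullet> ?d) + l\<^sup>2 * L ?d)"
    unfolding LZ pZ age_convex v by algebra
  ultimately show "v * ?W Y + l * ?W Z \<le> ?W (v *\<^sub>R Y + l *\<^sub>R Z)"
    unfolding v pV LV right_diff_distrib by linarith
qed

text \<open>
  Maximize \<open>u(t\<^sub>1, y) - L(y - x) / h\<close>, that is, take a proximal step.  By comparison with \<open>y = x\<close> a
  maximizer has distance at most \<open>speed * h\<close> from \<open>x\<close>, so it is interior, and the first-order condition
  says that \<open>p = B (x\<^sub>1 - x) / h\<close> is a supergradient in the space variable.  Concavity supplies the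
  matching time component.
\<close>
lemma euler_step_exists:
  assumes X: "(t, x) \<in> D" and t: "t < t1" and r: "speed * (t1 - t) < r"
    and sub: "\<And>y. dist x y \<le> r \<Longrightarrow> (t1, y) \<in> D"
  shows "\<exists>x1. euler_step (t, x) (t1, x1)"
proof -
  define h where "h = t1 - t"
  have h: "h > 0" using t by (simp add: h_def)
  have "0 \<le> speed * h" using h speed_nonneg by simp
  then have r0: "r > 0" using r by (simp add: h_def)
  let ?f = "\<lambda>y. u (t1, y) - L (y - x) / h"
  have "continuous_on (cball x r) ?f"
    by (intro continuous_intros continuous_on_compose2[OF continuous_u]) (use sub h in auto)
  moreover have "cball x r \<noteq> {}" using r0 by simp
  ultimately obtain x1 where x1: "x1 \<in> cball x r" "\<And>y. y \<in> cball x r \<Longrightarrow> ?f y \<le> ?f x1"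
    using continuous_attains_sup[OF compact_cball, of x r ?f] by blast
  let ?X1 = "(t1, x1)" and ?n = "norm (x1 - x)"
  have X1: "?X1 \<in> D" using x1(1) sub by simp
  have n: "?n \<le> speed * h"
  proof (cases "?n = 0")
    case False
    have "u ?X1 - u (t1, x) \<le> C * dist ?X1 (t1, x)"
      using lipschitz_onD[OF lip X1, of "(t1, x)"] sub[of x] r0 by (simp add: dist_real_def)
    also have "dist ?X1 (t1, x) = ?n" by (simp add: dist_Pair_Pair dist_norm)
    finally have "L (x1 - x) / h \<le> C * ?n"
      using x1(2)[of x] r0 by simp
    then have "L (x1 - x) \<le> C * ?n * h" using h by (simp add: divide_simps)
    then have "c / 2 * ?n\<^sup>2 \<le> C * ?n * h" using L_ge[of "x1 - x"] by linarith
    then have "?n * (c / 2 * ?n) \<le> ?n * (C * h)" by (simp add: power2_eq_square algebra_simps)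
    moreover have "?n > 0" using False by simp
    ultimately have "c / 2 * ?n \<le> C * h" by (simp only: mult_le_cancel_left_pos)
    then show ?thesis using c_pos by (simp add: speed_def field_simps)
  qed (use h speed_nonneg in simp)
  then have nr: "?n < r" using r by (simp add: h_def)
  define p where "p = (B *v (x1 - x)) /\<^sub>R h"
  have Ap: "h *\<^sub>R (A *v p) = x1 - x"
    using h by (simp add: p_def matrix_vector_mult_scaleR AB)
  define W where "W = (\<lambda>Y. age Y * (u Y - u ?X1) - age ?X1 * (p \<bullet> (snd Y - x1)) - L (snd Y - x1))"
  have slice: "W (t1, y) \<le> 0" if Y: "(t1, y) \<in> D" for y
  proof -
    have "age (t1, y) * (u (t1, y) - u ?X1) \<le> age ?X1 * (p \<bullet> (y - x1)) + L (snd (t1, y) - snd ?X1)"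
    proof (rule local_bound_imp_supergradient[OF X1 Y, where d = "(r - ?n) / (norm (y - x1) + 1)"
          and b = "L (y - x1) / h"])
      have n1: "norm (y - x1) + 1 > 0" using norm_ge_zero[of "y - x1"] by linarith
      then show "(r - ?n) / (norm (y - x1) + 1) > 0" using nr by simp
      fix l assume l: "0 < l" "l < (r - ?n) / (norm (y - x1) + 1)"
      then have "l * (norm (y - x1) + 1) < r - ?n" using n1 by (simp add: pos_less_divide_eq)
      moreover have "norm (l *\<^sub>R (y - x1)) \<le> l * (norm (y - x1) + 1)"
        using l(1) by (simp add: distrib_left)
      moreover have "norm ((x1 - x) + l *\<^sub>R (y - x1)) \<le> ?n + norm (l *\<^sub>R (y - x1))"
        by (rule norm_triangle_ineq)
      ultimately have "norm ((x1 - x) + l *\<^sub>R (y - x1)) \<le> r" by linarith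
      moreover define y' where "y' = x1 + l *\<^sub>R (y - x1)"
      moreover have y': "y' - x = (x1 - x) + l *\<^sub>R (y - x1)" by (simp add: y'_def)
      ultimately have "norm (y' - x) \<le> r" by (simp only: y')
      then have "y' \<in> cball x r" by (simp add: dist_norm norm_minus_commute)
      from x1(2)[OF this]
      have "u (t1, y') - u ?X1 \<le> (L ((x1 - x) + l *\<^sub>R (y - x1)) - L (x1 - x)) / h"
        unfolding y' diff_divide_distrib by simp
      also have "\<dots> = l * (p \<bullet> (y - x1)) + l\<^sup>2 * (L (y - x1) / h)"
        unfolding L_add L_scale using h by (simp add: p_def divide_simps)
      finally show "u (?X1 + l *\<^sub>R ((t1, y) - ?X1)) - u ?X1 \<le>
          l * (p \<bullet> (y - x1)) + l\<^sup>2 * (L (y - x1) / h)"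
        by (simp add: y'_def)
    qed
    then show ?thesis by (simp add: W_def)
  qed
  have "concave_on D W"
    using supergradient_defect_concave[of ?X1 "age ?X1" p] by (simp add: W_def)
  then obtain a where a: "\<And>t y. (t, y) \<in> D \<Longrightarrow> W (t, y) \<le> a * (t - t1)"
    using concave_time_slope[of D W t1 x1, OF _ open_D X1 slice] by blast
  have "(a / age ?X1, p) \<in> supergradients ?X1"
    unfolding supergradients_def
  proof (intro CollectI ballI)
    fix Y assume "Y \<in> D"
    then have "W Y \<le> a * (fst Y - t1)" using a[of "fst Y" "snd Y"] by simp
    then show "age Y * (u Y - u ?X1) \<le> age ?X1 * ((a / age ?X1, p) \<bullet> (Y - ?X1)) + L (snd Y - snd ?X1)"
      using age_pos[OF X1] by (simp add: W_def inner_prod_def distrib_left)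
  qed
  then have "euler_step (t, x) ?X1"
    unfolding euler_step_def using X X1 t Ap by (auto simp: h_def intro!: bexI[of _ "(a / age ?X1, p)"])
  then show ?thesis by blast
qed

lemma supergradients_closed_limit:
  assumes X: "X \<in> D" and Y: "\<And>n. Y n \<in> D" "Y \<longlonglongrightarrow> X"
    and P: "\<And>n. P n \<in> supergradients (Y n)" "P \<longlonglongrightarrow> Q"
  shows "Q \<in> supergradients X"
  unfolding supergradients_def
proof (intro CollectI ballI)
  fix Z assume Z: "Z \<in> D"
  define f where "f V = age Z * (u Z - u (fst V)) -
    (age (fst V) * (snd V \<bullet> (Z - fst V)) + L (snd Z - snd (fst V)))" for V
  have cont: "continuous_on (D \<times> UNIV) f"
    unfolding f_def age_def
    by (intro continuous_intros continuous_on_compose2[OF continuous_u]) auto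
  have "(\<lambda>n. f (Y n, P n)) \<longlonglongrightarrow> f (X, Q)"
    using X Y(1) by (intro continuous_on_tendsto_compose[OF cont tendsto_Pair[OF Y(2) P(2)]]) simp_all
  moreover have "f (Y n, P n) \<le> 0" for n
    using supergradientsD[OF P(1) Z] by (simp add: f_def)
  ultimately have "f (X, Q) \<le> 0" using LIMSEQ_le_const2 by blast
  then show "age Z * (u Z - u X) \<le> age X * (Q \<bullet> (Z - X)) + L (snd Z - snd X)"
    by (simp add: f_def)
qed

section \<open>Energy-minimizing supergradients\<close>

text \<open>
  Supergradients at points tending to \<open>X\<close> are bounded, and their limits are supergradients at \<open>X\<close>.  With
  a closed set \<open>S\<close> of forbidden pairs, one statement gives both the continuity of low-energy
  supergradients and the lower semicontinuity of the energy.
\<close>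

lemma supergradients_upper_semicontinuous:
  assumes X: "X \<in> D" and S: "closed S"
    and none: "\<And>P. P \<in> supergradients X \<Longrightarrow> (X, P) \<notin> S"
  shows "\<exists>d>0. \<forall>Y\<in>D. dist Y X < d \<longrightarrow> (\<forall>P\<in>supergradients Y. (Y, P) \<notin> S)"
proof (rule ccontr)
  assume "\<not> ?thesis"
  then have "\<exists>Y P. Y \<in> D \<and> dist Y X < inverse (real (Suc n)) \<and> P \<in> supergradients Y \<and> (Y, P) \<in> S" for n
    by (metis inverse_positive_iff_positive of_nat_0_less_iff zero_less_Suc)
  then obtain Y P where Y: "\<And>n. Y n \<in> D" "\<And>n. dist (Y n) X < inverse (real (Suc n))"
      and P: "\<And>n. P n \<in> supergradients (Y n)" "\<And>n. (Y n, P n) \<in> S"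
    by metis
  have "dist (Y n) X \<le> inverse (real (Suc n))" for n using Y(2)[of n] by simp
  then have "(\<lambda>n. dist (Y n) X) \<longlonglongrightarrow> 0"
    by (intro tendsto_sandwich[OF _ _ tendsto_const LIMSEQ_inverse_real_of_nat] always_eventually)
      simp_all
  then have YX: "Y \<longlonglongrightarrow> X" using tendsto_dist_iff by blast
  have "\<forall>n. P n \<in> cball 0 C" using norm_supergradient_le[OF Y(1) P(1)] by simp
  then obtain Q r where r: "strict_mono r" "(P \<circ> r) \<longlonglongrightarrow> Q"
    using compact_cball[of "0 :: real \<times> (real^'n)" C] unfolding compact_def by blast
  have Yr: "(Y \<circ> r) \<longlonglongrightarrow> X" using YX r(1) by (rule LIMSEQ_subseq_LIMSEQ)
  have "Q \<in> supergradients X"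
    by (rule supergradients_closed_limit[OF X _ Yr _ r(2)]) (use Y P in auto)
  moreover have "(X, Q) \<in> S"
  proof (rule closed_sequentially[OF S])
    show "((Y \<circ> r) n, (P \<circ> r) n) \<in> S" for n using P(2) by simp
    show "(\<lambda>n. ((Y \<circ> r) n, (P \<circ> r) n)) \<longlonglongrightarrow> (X, Q)" by (rule tendsto_Pair[OF Yr r(2)])
  qed
  ultimately show False by (simp add: none)
qed

lemma continuous_F [continuous_intros]: "continuous_on S f \<Longrightarrow> continuous_on S (\<lambda>x. F (f x))"
  unfolding full_hamiltonian_def hamiltonian_def
  by (intro continuous_intros bounded_linear.continuous_on[OF matrix_vector_mul_bounded_linear])

lemma compact_supergradients: "X \<in> D \<Longrightarrow> compact (supergradients X)"
proof -
  assume X: "X \<in> D"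
  have "closed (supergradients X)"
    unfolding closed_sequential_limits
  proof (intro allI impI)
    fix P Q assume "(\<forall>n. P n \<in> supergradients X) \<and> P \<longlonglongrightarrow> Q"
    then show "Q \<in> supergradients X"
      by (intro supergradients_closed_limit[OF X X tendsto_const, of P Q]) simp_all
  qed
  moreover have "bounded (supergradients X)"
    by (rule boundedI) (rule norm_supergradient_le[OF X])
  ultimately show ?thesis by (simp add: compact_eq_bounded_closed)
qed

text \<open>The choice is unambiguous: see \<open>energy_minimizer_unique\<close>.\<close>
definition energy_minimizer :: "real \<times> (real^'n) \<Rightarrow> real \<times> (real^'n)" where
  "energy_minimizer X = (SOME P. P \<in> supergradients X \<and> (\<forall>Q\<in>supergradients X. F P \<le> F Q))"

lemma
  assumes "X \<in> D"
  shows energy_minimizer_in: "energy_minimizer X \<in> supergradients X"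
    and energy_minimizer_le: "Q \<in> supergradients X \<Longrightarrow> F (energy_minimizer X) \<le> F Q"
proof -
  have "continuous_on (supergradients X) F"
    using continuous_F[OF continuous_on_id] by simp
  then have "\<exists>P. P \<in> supergradients X \<and> (\<forall>Q\<in>supergradients X. F P \<le> F Q)"
    by (rule continuous_attains_inf[OF compact_supergradients[OF assms]
          supergradients_nonempty[OF assms], unfolded Bex_def])
  from someI_ex[OF this, folded energy_minimizer_def]
  have *: "energy_minimizer X \<in> supergradients X \<and>
      (\<forall>Q\<in>supergradients X. F (energy_minimizer X) \<le> F Q)" .
  show "energy_minimizer X \<in> supergradients X" using * by (rule conjunct1)
  show "F (energy_minimizer X) \<le> F Q" if "Q \<in> supergradients X" using conjunct2[OF *] that by (rule bspec)
qed

lemma hamiltonian_eq_L: "hamiltonian A p = L (A *v p)"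
  using L_velocity[of 1 p] by simp

text \<open>
  \<open>F\<close> is strictly convex only in the space component.  The midpoint of two minimizers would have smaller
  energy unless their space components agree, and then equality of the energies forces equality of the
  time components.
\<close>
lemma energy_minimizer_unique:
  assumes X: "X \<in> D" and Q: "Q \<in> supergradients X" and le: "F Q \<le> F (energy_minimizer X)"
  shows "Q = energy_minimizer X"
proof -
  let ?P = "energy_minimizer X"
  let ?M = "(1 / 2) *\<^sub>R ?P + (1 / 2) *\<^sub>R Q"
  note P = energy_minimizer_in[OF X]
  have "?M \<in> supergradients X"
    unfolding supergradients_def
  proof (intro CollectI ballI)
    fix Y assume Y: "Y \<in> D"
    show "age Y * (u Y - u X) \<le> age X * (?M \<bullet> (Y - X)) + L (snd Y - snd X)"
    proof -
      have M: "?M \<bullet> (Y - X) = (?P \<bullet> (Y - X) + Q \<bullet> (Y - X)) / 2"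
        by (simp only: inner_add_left inner_scaleR_left) simp
      have average: "a \<le> (b + b') / 2 + d" if "a \<le> b + d" "a \<le> b' + d" for a b b' d :: real
        using that by (simp add: field_simps)
      show ?thesis
        using average[OF supergradientsD[OF P Y] supergradientsD[OF Q Y]]
        by (simp only: M distrib_left times_divide_eq_right)
    qed
  qed
  then have "F ?P \<le> F ?M" by (rule energy_minimizer_le[OF X])
  moreover have "F ?M = (F ?P + F Q) / 2 - hamiltonian A (snd Q - snd ?P) / 4"
  proof -
    let ?a = "A *v snd ?P" and ?b = "A *v snd Q"
    have "A *v snd ?M = (1 / 2) *\<^sub>R ?a + (1 / 2) *\<^sub>R ?b"
      by (simp add: matrix_vector_right_distrib matrix_vector_mult_scaleR)
    then have "hamiltonian A (snd ?M) = L ((1 / 2) *\<^sub>R ?a + (1 / 2) *\<^sub>R ?b)"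
      by (simp only: hamiltonian_eq_L)
    also have "\<dots> = L ?a / 4 + (snd ?P \<bullet> ?b) / 4 + L ?b / 4"
      by (simp only: L_add L_scale matrix_vector_mult_scaleR BA inner_scaleR_left inner_scaleR_right)
        (simp add: power2_eq_square)
    finally have M: "hamiltonian A (snd ?M) = L ?a / 4 + (snd ?P \<bullet> ?b) / 4 + L ?b / 4" .
    have "snd Q \<bullet> ?a = snd ?P \<bullet> ?b" using B_sym[of ?a ?b] by (simp add: BA inner_commute)
    then have "hamiltonian A (snd Q - snd ?P) = L ?b - snd ?P \<bullet> ?b + L ?a"
      by (simp only: hamiltonian_eq_L matrix_vector_mult_diff_distrib L_diff BA)
    moreover have "fst ?M = (fst ?P + fst Q) / 2" by simp
    ultimately show ?thesis
      using M hamiltonian_eq_L[of "snd ?P"] hamiltonian_eq_L[of "snd Q"]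
      unfolding full_hamiltonian_def by (simp only:) (simp add: field_simps)
  qed
  ultimately have "hamiltonian A (snd Q - snd ?P) \<le> 0"
    using le by (simp add: field_simps)
  then have s: "snd Q = snd ?P"
    using spd unfolding sym_pos_def_def hamiltonian_def
    by (metis half_gt_zero_iff mult.commute mult_1 not_less right_minus_eq times_divide_eq_left)
  have "F Q = F ?P" using le energy_minimizer_le[OF X Q] by simp
  then have "fst Q = fst ?P" using s by (simp add: full_hamiltonian_def)
  then show ?thesis using s by (rule prod_eqI)
qed

definition energy :: "real \<times> (real^'n) \<Rightarrow> real" where
  "energy X = (age X)\<^sup>2 * F (energy_minimizer X)"

text \<open>
  The energy bound survives in the limit \<open>Y \<longlonglongrightarrow> X\<close>, so a limit of such \<open>P\<close> is a minimizer at \<open>X\<close>.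
\<close>
lemma low_energy_near_minimizer:
  assumes X: "X \<in> D" and e: "e > 0"
  shows "\<exists>d>0. \<forall>Y\<in>D. dist Y X < d \<longrightarrow>
    (\<forall>P\<in>supergradients Y. (age Y)\<^sup>2 * F P \<le> energy X \<longrightarrow> dist P (energy_minimizer X) < e)"
proof -
  let ?S = "{Z. (age (fst Z))\<^sup>2 * F (snd Z) \<le> energy X} \<inter> {Z. e \<le> dist (snd Z) (energy_minimizer X)}"
  have "closed ?S"
    unfolding age_def by (intro closed_Int closed_Collect_le continuous_intros)
  moreover have "(X, P) \<notin> ?S" if "P \<in> supergradients X" for P
  proof
    assume S: "(X, P) \<in> ?S"
    then have "F P \<le> F (energy_minimizer X)"
      using age_pos[OF X] by (simp add: energy_def)
    then show False using energy_minimizer_unique[OF X that] S e by simp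
  qed
  ultimately have "\<exists>d>0. \<forall>Y\<in>D. dist Y X < d \<longrightarrow> (\<forall>P\<in>supergradients Y. (Y, P) \<notin> ?S)"
    by (rule supergradients_upper_semicontinuous[OF X])
  then obtain d where d: "d > 0"
      "\<forall>Y\<in>D. dist Y X < d \<longrightarrow> (\<forall>P\<in>supergradients Y. (Y, P) \<notin> ?S)"
    by (elim exE conjE)
  show ?thesis
  proof (intro exI[of _ d] conjI ballI impI d(1))
    fix Y P assume *: "Y \<in> D" "dist Y X < d" "P \<in> supergradients Y" "(age Y)\<^sup>2 * F P \<le> energy X"
    then have "(Y, P) \<notin> ?S" using d(2) by simp
    then show "dist P (energy_minimizer X) < e" using *(4) by simp
  qed
qed

lemma energy_lower_semicontinuous:
  assumes X: "X \<in> D" and k: "k < energy X"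
  shows "\<exists>d>0. \<forall>Y\<in>D. dist Y X < d \<longrightarrow> k < energy Y"
proof -
  let ?S = "{Z. (age (fst Z))\<^sup>2 * F (snd Z) \<le> k}"
  have "closed ?S"
    unfolding age_def by (intro closed_Collect_le continuous_intros)
  moreover have "(X, P) \<notin> ?S" if "P \<in> supergradients X" for P
  proof -
    have "energy X \<le> (age X)\<^sup>2 * F P"
      using energy_minimizer_le[OF X that] by (simp add: energy_def mult_left_mono)
    then show ?thesis using k by simp
  qed
  ultimately have "\<exists>d>0. \<forall>Y\<in>D. dist Y X < d \<longrightarrow> (\<forall>P\<in>supergradients Y. (Y, P) \<notin> ?S)"
    by (rule supergradients_upper_semicontinuous[OF X])
  then obtain d where d: "d > 0"
      "\<forall>Y\<in>D. dist Y X < d \<longrightarrow> (\<forall>P\<in>supergradients Y. (Y, P) \<notin> ?S)"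
    by (elim exE conjE)
  show ?thesis
  proof (intro exI[of _ d] conjI ballI impI d(1))
    fix Y assume *: "Y \<in> D" "dist Y X < d"
    then have "(Y, energy_minimizer Y) \<notin> ?S" using d(2) energy_minimizer_in[of Y] by simp
    then show "k < energy Y" by (simp add: energy_def)
  qed
qed

section \<open>Limits of Euler polygons\<close>

abbreviation reaches :: "real \<times> (real^'n) \<Rightarrow> real \<times> (real^'n) \<Rightarrow> bool" where
  "reaches \<equiv> euler_step\<^sup>*\<^sup>*"

lemma reaches_bounds:
  assumes "reaches X Z" and X: "X \<in> D"
  shows "Z \<in> D \<and> fst X \<le> fst Z \<and> norm (snd Z - snd X) \<le> speed * (fst Z - fst X) \<and>
    energy Z \<le> energy X"
  using assms(1)
proof (induction rule: rtranclp_induct)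
  case base
  then show ?case using X by simp
next
  case (step Y Z)
  then obtain P where P: "Z \<in> D" "Y \<in> D" "fst Y < fst Z" "P \<in> supergradients Z"
      "snd Z - snd Y = (fst Z - fst Y) *\<^sub>R (A *v snd P)"
    unfolding euler_step_def by blast
  have "energy Z \<le> (age Z)\<^sup>2 * F P"
    using energy_minimizer_le[OF P(1,4)] by (simp add: energy_def mult_left_mono)
  also have "\<dots> \<le> energy Y"
    unfolding energy_def by (rule euler_step_energy[OF P(2) energy_minimizer_in[OF P(2)] P(1,4,3,5)])
  finally have en: "energy Z \<le> energy Y" .
  have "norm (snd Z - snd Y) \<le> speed * (fst Z - fst Y)"
    unfolding P(5) using supergradient_velocity_le[OF P(1,4)] P(3)
    by (simp add: mult.commute mult_right_mono)
  moreover have "norm (snd Z - snd X) \<le> norm (snd Z - snd Y) + norm (snd Y - snd X)"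
    using norm_triangle_ineq[of "snd Z - snd Y" "snd Y - snd X"] by simp
  ultimately show ?case using step.IH P(1,3) en by (auto simp: algebra_simps)
qed

lemma dist_le_of_speed:
  assumes "norm (snd Z - snd X) \<le> speed * (fst Z - fst X)" and "fst X \<le> fst Z"
  shows "dist Z X \<le> (1 + speed) * (fst Z - fst X)"
proof -
  have "norm (Z - X) \<le> norm (fst (Z - X)) + norm (snd (Z - X))"
    by (metis norm_Pair_le prod.collapse)
  then show ?thesis using assms by (simp add: dist_norm algebra_simps)
qed

text \<open>
  Along a short polygon from \<open>X\<close> the supergradients of all steps have weighted energy at most that of \<open>X\<close>,
  so they are close to the minimizer at \<open>X\<close>, and hence so is the mean velocity.
\<close>
lemma reaches_initial_velocity:
  assumes X: "X \<in> D" and e: "e > 0"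
  shows "\<exists>d>0. \<forall>Z. reaches X Z \<longrightarrow> fst Z - fst X < d \<longrightarrow>
    norm (snd Z - snd X - (fst Z - fst X) *\<^sub>R (A *v snd (energy_minimizer X))) \<le> e * (fst Z - fst X)"
proof -
  let ?P = "energy_minimizer X"
  obtain d where d: "d > 0" "\<And>Y P. Y \<in> D \<Longrightarrow> dist Y X < d \<Longrightarrow> P \<in> supergradients Y \<Longrightarrow>
      (age Y)\<^sup>2 * F P \<le> energy X \<Longrightarrow> dist P ?P < c * e"
    using low_energy_near_minimizer[OF X, of "c * e"] c_pos e by auto
  define d' where "d' = d / (1 + speed)"
  have s1: "1 + speed > 0" using speed_nonneg by simp
  then have d': "d' > 0" using d(1) by (simp add: d'_def)
  have "fst Z - fst X < d' \<longrightarrow>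
      norm (snd Z - snd X - (fst Z - fst X) *\<^sub>R (A *v snd ?P)) \<le> e * (fst Z - fst X)"
    if "reaches X Z" for Z
    using that
  proof (induction rule: rtranclp_induct)
    case base
    show ?case by simp
  next
    case (step Y Z)
    show ?case
    proof
      assume close: "fst Z - fst X < d'"
      obtain P where P: "Z \<in> D" "Y \<in> D" "fst Y < fst Z" "P \<in> supergradients Z"
          "snd Z - snd Y = (fst Z - fst Y) *\<^sub>R (A *v snd P)"
        using step.hyps(2) unfolding euler_step_def by blast
      have bZ: "fst X \<le> fst Z" "norm (snd Z - snd X) \<le> speed * (fst Z - fst X)"
        using reaches_bounds[OF rtranclp.rtrancl_into_rtrancl[OF step.hyps] X] by auto
      have eY: "energy Y \<le> energy X" using reaches_bounds[OF step.hyps(1) X] by blast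
      have "dist Z X \<le> (1 + speed) * (fst Z - fst X)" using dist_le_of_speed bZ by blast
      also have "\<dots> < d" using close s1 by (simp add: d'_def pos_less_divide_eq mult.commute)
      finally have "dist Z X < d" .
      moreover have "(age Z)\<^sup>2 * F P \<le> energy Y"
        unfolding energy_def by (rule euler_step_energy[OF P(2) energy_minimizer_in[OF P(2)] P(1,4,3,5)])
      ultimately have "dist P ?P < c * e" using d(2) P(1,4) eY by auto
      then have "norm (snd P - snd ?P) \<le> c * e"
        using dist_snd_le[of P ?P] by (simp add: dist_norm)
      then have v: "norm (A *v (snd P - snd ?P)) \<le> e"
        using velocity_bound[of "snd P - snd ?P"] c_pos
          divide_right_mono[of "norm (snd P - snd ?P)" "c * e" c] by simp
      let ?r = "\<lambda>Z. snd Z - snd X - (fst Z - fst X) *\<^sub>R (A *v snd ?P)"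
      have "(snd Z - snd Y) - (fst Z - fst Y) *\<^sub>R (A *v snd ?P) =
          (fst Z - fst Y) *\<^sub>R (A *v (snd P - snd ?P))"
        unfolding P(5) by (simp add: matrix_vector_mult_diff_distrib scaleR_diff_right)
      then have "?r Z = ?r Y + (fst Z - fst Y) *\<^sub>R (A *v (snd P - snd ?P))"
        by (simp add: algebra_simps)
      then have "norm (?r Z) \<le> norm (?r Y) + norm ((fst Z - fst Y) *\<^sub>R (A *v (snd P - snd ?P)))"
        by (simp only: norm_triangle_ineq)
      also have "norm (?r Y) \<le> e * (fst Y - fst X)" using step.IH close P(3) by simp
      also have "norm ((fst Z - fst Y) *\<^sub>R (A *v (snd P - snd ?P))) \<le> (fst Z - fst Y) * e"
        using v P(3) by (simp add: mult_left_mono)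
      finally show "norm (?r Z) \<le> e * (fst Z - fst X)" by (simp add: algebra_simps)
    qed
  qed
  then show ?thesis using d' by blast
qed

text \<open>Passing between the norm given by \<open>L\<close>, in which polygons do not separate, and the Euclidean norm.\<close>
lemma L_controls_norm:
  assumes "0 \<le> k" and "L q \<le> k\<^sup>2 * L r"
  shows "norm q \<le> sqrt (onorm ((*v) B) / c) * k * norm r"
proof (rule power2_le_imp_le)
  have o: "0 \<le> onorm ((*v) B)" by (rule onorm_pos_le[OF matrix_vector_mul_bounded_linear])
  have "c / 2 * (norm q)\<^sup>2 \<le> k\<^sup>2 * L r" using L_ge[of q] assms(2) by linarith
  also have "\<dots> \<le> k\<^sup>2 * (onorm ((*v) B) / 2 * (norm r)\<^sup>2)"
    by (intro mult_left_mono L_le) simp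
  finally have "c * (norm q)\<^sup>2 \<le> k\<^sup>2 * (onorm ((*v) B) * (norm r)\<^sup>2)" by simp
  then have "(norm q)\<^sup>2 \<le> k\<^sup>2 * (onorm ((*v) B) * (norm r)\<^sup>2) / c"
    using c_pos by (simp add: pos_le_divide_eq mult.commute)
  also have "\<dots> = (sqrt (onorm ((*v) B) / c) * k * norm r)\<^sup>2"
    using o c_pos by (simp add: power_mult_distrib)
  finally show "(norm q)\<^sup>2 \<le> (sqrt (onorm ((*v) B) / c) * k * norm r)\<^sup>2" .
  show "0 \<le> sqrt (onorm ((*v) B) / c) * k * norm r" using o c_pos assms(1) by simp
qed

text \<open>
  Lower semicontinuity of the energy is what is needed at the end point \<open>Y\<close>; the starting point \<open>X\<close> is the
  same for all the polygons.
\<close>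
lemma closure_reaches_bounds:
  assumes X: "X \<in> D" and Y: "Y \<in> D" and XY: "Y \<in> closure {Z. reaches X Z}"
  shows "norm (snd Y - snd X) \<le> speed * (fst Y - fst X)" and "energy Y \<le> energy X"
proof -
  let ?S = "{Z. norm (snd Z - snd X) \<le> speed * (fst Z - fst X)}"
  have "closed ?S" by (intro closed_Collect_le continuous_intros)
  moreover have "{Z. reaches X Z} \<subseteq> ?S" using reaches_bounds[OF _ X] by blast
  ultimately show "norm (snd Y - snd X) \<le> speed * (fst Y - fst X)"
    using closure_minimal[of "{Z. reaches X Z}" ?S] XY by blast
  show "energy Y \<le> energy X"
  proof (rule ccontr)
    assume "\<not> energy Y \<le> energy X"
    then obtain d where d: "d > 0" "\<forall>Z\<in>D. dist Z Y < d \<longrightarrow> energy X < energy Z"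
      using energy_lower_semicontinuous[OF Y, of "energy X"] by auto
    obtain Z where "reaches X Z" "dist Z Y < d"
      using XY d(1) unfolding closure_approachable by blast
    then show False using d(2) reaches_bounds[OF _ X, of Z] by force
  qed
qed

lemma closure_reaches_initial_velocity:
  assumes X: "X \<in> D" and e: "e > 0"
  shows "\<exists>d>0. \<forall>Y. Y \<in> closure {Z. reaches X Z} \<longrightarrow> fst Y - fst X < d \<longrightarrow>
    norm (snd Y - snd X - (fst Y - fst X) *\<^sub>R (A *v snd (energy_minimizer X))) \<le> e * (fst Y - fst X)"
proof -
  let ?v = "A *v snd (energy_minimizer X)"
  obtain d where d: "d > 0" "\<forall>Z. reaches X Z \<longrightarrow> fst Z - fst X < d \<longrightarrow>
      norm (snd Z - snd X - (fst Z - fst X) *\<^sub>R ?v) \<le> e * (fst Z - fst X)"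
    using reaches_initial_velocity[OF X e] by (elim exE conjE)
  let ?S = "{Z. d \<le> fst Z - fst X} \<union>
    {Z. norm (snd Z - snd X - (fst Z - fst X) *\<^sub>R ?v) \<le> e * (fst Z - fst X)}"
  have "closed ?S" by (intro closed_Un closed_Collect_le continuous_intros)
  moreover have "{Z. reaches X Z} \<subseteq> ?S" using d(2) by force
  ultimately have S: "closure {Z. reaches X Z} \<subseteq> ?S" by (rule closure_minimal[rotated])
  show ?thesis
  proof (intro exI[of _ d] conjI allI impI d(1))
    fix Y assume *: "Y \<in> closure {Z. reaches X Z}" "fst Y - fst X < d"
    show "norm (snd Y - snd X - (fst Y - fst X) *\<^sub>R ?v) \<le> e * (fst Y - fst X)"
      using subsetD[OF S *(1)] *(2) by simp
  qed
qed

text \<open>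
  The cone \<open>|x - x0| \<le> speed * (t - t0)\<close> is invariant under Euler steps, and up to time \<open>t0 + T\<close> it keeps
  a positive distance from the lateral boundary of \<open>{t0..t0 + T} \<times> cball x0 \<rho>\<close>, so that steps of every
  size are possible.
\<close>
lemma euler_step_in_cone:
  assumes room: "{t0..t0 + T} \<times> cball x0 \<rho> \<subseteq> D"
    and T: "speed * T < \<rho>"
    and x: "t0 \<le> t" "norm (x - x0) \<le> speed * (t - t0)" and t: "t < t1" "t1 \<le> t0 + T"
  shows "\<exists>x1. euler_step (t, x) (t1, x1) \<and> norm (x1 - x0) \<le> speed * (t1 - t0)"
proof -
  have le: "speed * (s - t0) \<le> speed * T" if "s \<le> t0 + T" for s
    using that speed_nonneg by (intro mult_left_mono) auto
  have X: "(t, x) \<in> D"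
  proof -
    have "dist x0 x \<le> \<rho>" using x t le[of t] T by (simp add: dist_norm norm_minus_commute)
    then show ?thesis using subsetD[OF room, of "(t, x)"] x(1) t by simp
  qed
  define r where "r = speed * (t1 - t) + (\<rho> - speed * T)"
  have "(t1, y) \<in> D" if "dist x y \<le> r" for y
  proof -
    have "dist x0 y \<le> norm (x - x0) + dist x y"
      using dist_triangle[of x0 y x] by (simp add: dist_norm norm_minus_commute)
    also have "\<dots> \<le> speed * (t - t0) + r" using x that by simp
    also have "\<dots> = speed * (t1 - t0) + (\<rho> - speed * T)" by (simp add: r_def algebra_simps)
    also have "\<dots> \<le> \<rho>" using le[of t1] t by simp
    finally have "dist x0 y \<le> \<rho>" .
    then show ?thesis using subsetD[OF room, of "(t1, y)"] x(1) t by simp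
  qed
  then obtain x1 where x1: "euler_step (t, x) (t1, x1)"
    using euler_step_exists[OF X t(1), of r] T by (auto simp: r_def)
  have "norm (x1 - x) \<le> speed * (t1 - t)"
    using reaches_bounds[OF r_into_rtranclp[of euler_step, OF x1] X] by simp
  moreover have "norm (x1 - x0) \<le> norm (x1 - x) + norm (x - x0)"
    using norm_triangle_ineq[of "x1 - x" "x - x0"] by simp
  ultimately have "norm (x1 - x0) \<le> speed * (t1 - t0)" using x by (simp add: algebra_simps)
  then show ?thesis using x1 by blast
qed

lemma euler_polygon_exists:
  fixes \<theta> :: "nat \<Rightarrow> real"
  assumes room: "{t0..t0 + T} \<times> cball x0 \<rho> \<subseteq> D"
    and T: "speed * T < \<rho>"
    and x: "t0 \<le> \<theta> 0" "norm (x - x0) \<le> speed * (\<theta> 0 - t0)"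
  shows "(\<And>k. k < N \<Longrightarrow> \<theta> k < \<theta> (Suc k)) \<Longrightarrow> \<theta> N \<le> t0 + T \<Longrightarrow>
    \<exists>f. f 0 = x \<and> (\<forall>k<N. euler_step (\<theta> k, f k) (\<theta> (Suc k), f (Suc k))) \<and>
      (\<forall>k\<le>N. t0 \<le> \<theta> k \<and> norm (f k - x0) \<le> speed * (\<theta> k - t0))"
proof (induction N)
  case 0
  then show ?case using x by (intro exI[of _ "\<lambda>_. x"]) simp
next
  case (Suc N)
  have lt: "\<theta> N < \<theta> (Suc N)" using Suc.prems(1) by simp
  have inc: "\<theta> k < \<theta> (Suc k)" if "k < N" for k using Suc.prems(1) that by simp
  have le: "\<theta> N \<le> t0 + T" using lt Suc.prems(2) by linarith
  obtain f where f: "f 0 = x" "\<forall>k<N. euler_step (\<theta> k, f k) (\<theta> (Suc k), f (Suc k))"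
      "\<forall>k\<le>N. t0 \<le> \<theta> k \<and> norm (f k - x0) \<le> speed * (\<theta> k - t0)"
    using Suc.IH[OF _ le] inc by blast
  have fN: "t0 \<le> \<theta> N" "norm (f N - x0) \<le> speed * (\<theta> N - t0)" using f(3) by auto
  obtain x1 where x1: "euler_step (\<theta> N, f N) (\<theta> (Suc N), x1)"
      "norm (x1 - x0) \<le> speed * (\<theta> (Suc N) - t0)"
    using euler_step_in_cone[OF room T fN lt Suc.prems(2)] by (elim exE conjE)
  let ?f = "f(Suc N := x1)"
  have "\<forall>k<Suc N. euler_step (\<theta> k, ?f k) (\<theta> (Suc k), ?f (Suc k))"
    using f(2) x1(1) by (simp add: less_Suc_eq)
  moreover have "\<forall>k\<le>Suc N. t0 \<le> \<theta> k \<and> norm (?f k - x0) \<le> speed * (\<theta> k - t0)"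
    using f(3) x1(2) order_trans[OF fN(1) less_imp_le[OF lt]] by (simp add: le_Suc_eq)
  ultimately show ?case using f(1) by (intro exI[of _ ?f]) simp
qed

lemma euler_polygon_reaches:
  fixes \<theta> :: "nat \<Rightarrow> real"
  assumes "\<forall>k<N. euler_step (\<theta> k, f k) (\<theta> (Suc k), f (Suc k))" and "k \<le> N"
  shows "reaches (\<theta> 0, f 0) (\<theta> k, f k)"
  using assms(2)
proof (induction k)
  case (Suc k)
  then show ?case using assms(1) by (meson Suc_le_eq Suc_leD rtranclp.rtrancl_into_rtrancl)
qed simp

lemma euler_polygons_nonexpansive:
  fixes \<theta> :: "nat \<Rightarrow> real"
  assumes f: "\<forall>k<N. euler_step (\<theta> k, f k) (\<theta> (Suc k), f (Suc k))"
    and h: "\<forall>k<N. euler_step (\<theta> k, h k) (\<theta> (Suc k), h (Suc k))" and k: "k \<le> N"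
  shows "L (h k - f k) / (\<theta> k - tbar)\<^sup>2 \<le> L (h 0 - f 0) / (\<theta> 0 - tbar)\<^sup>2"
  using k
proof (induction k)
  case (Suc k)
  then have "k < N" by simp
  then have "L (h (Suc k) - f (Suc k)) / (\<theta> (Suc k) - tbar)\<^sup>2 \<le> L (h k - f k) / (\<theta> k - tbar)\<^sup>2"
    using euler_step_nonexpansive[of "(\<theta> k, f k)" "(\<theta> (Suc k), f (Suc k))"
        "(\<theta> k, h k)" "(\<theta> (Suc k), h (Suc k))"] f h by (simp add: age_def)
  also have "\<dots> \<le> L (h 0 - f 0) / (\<theta> 0 - tbar)\<^sup>2" using Suc by simp
  finally show ?case .
qed simp

text \<open>
  From each of its points, and not only from the first, the curve is approximated by polygons that start
  exactly there.
\<close>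
definition euler_limit :: "real \<Rightarrow> real \<Rightarrow> (real \<Rightarrow> real^'n) \<Rightarrow> bool" where
  "euler_limit t0 T x \<longleftrightarrow>
     (\<forall>s. t0 \<le> s \<and> s < t0 + T \<longrightarrow> (s, x s) \<in> D) \<and>
     (\<forall>s1 s2. t0 \<le> s1 \<and> s1 < s2 \<and> s2 < t0 + T \<longrightarrow>
        (s2, x s2) \<in> closure {Z. reaches (s1, x s1) Z})"

lemma euler_limitD:
  assumes "euler_limit t0 T x"
  shows "t0 \<le> s \<Longrightarrow> s < t0 + T \<Longrightarrow> (s, x s) \<in> D"
    and "t0 \<le> r \<Longrightarrow> r < s \<Longrightarrow> s < t0 + T \<Longrightarrow> (s, x s) \<in> closure {Z. reaches (r, x r) Z}"
  using assms unfolding euler_limit_def by blast+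

text \<open>
  The curve \<open>x\<close> is a cluster point of the polygons with equidistant times.  Given \<open>s\<^sub>1 < s\<^sub>2\<close>, start at
  \<open>(s\<^sub>1, x s\<^sub>1)\<close>, make one short step to the next grid time of a fine polygon that is close to \<open>x\<close> at both
  \<open>s\<^sub>1\<close> and \<open>s\<^sub>2\<close>, and continue on the same grid.  The two polygons are close at the first common time, so by
  nonexpansiveness they are still close at \<open>s\<^sub>2\<close>.
\<close>
theorem euler_limit_exists:
  assumes room: "{t0..t0 + T} \<times> cball x0 \<rho> \<subseteq> D" and T: "0 < T" "speed * T < \<rho>"
  obtains x where "euler_limit t0 T x" and "x t0 = x0"
proof -
  have rho: "\<rho> > 0" using T speed_nonneg mult_nonneg_nonneg[of speed T] by linarith
  define h where "h n = T / real (Suc n)" for n :: nat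
  have h: "h n > 0" for n using T by (simp add: h_def)
  define G where "G n k = t0 + real k * h n" for n k :: nat
  have G_mono: "G n k < G n (Suc k)" for n k using h[of n] by (simp add: G_def distrib_right)
  have G_last: "G n (Suc n) = t0 + T" for n by (simp add: G_def h_def)
  have "\<exists>f. f 0 = x0 \<and> (\<forall>k<Suc n. euler_step (G n k, f k) (G n (Suc k), f (Suc k))) \<and>
      (\<forall>k\<le>Suc n. t0 \<le> G n k \<and> norm (f k - x0) \<le> speed * (G n k - t0))" for n
  proof (rule euler_polygon_exists[OF room T(2)])
    show "t0 \<le> G n 0" "norm (x0 - x0) \<le> speed * (G n 0 - t0)" by (simp_all add: G_def)
    show "G n k < G n (Suc k)" for k by (rule G_mono)
    show "G n (Suc n) \<le> t0 + T" using G_last[of n] by (simp only:)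
  qed
  then obtain f where f: "\<And>n k. k < Suc n \<Longrightarrow> euler_step (G n k, f n k) (G n (Suc k), f n (Suc k))"
      "\<And>n k. k \<le> Suc n \<Longrightarrow> norm (f n k - x0) \<le> speed * (G n k - t0)"
    by metis
  \<comment> \<open>the index of the first grid time strictly after \<open>s\<close>, so that there is room for a step from \<open>s\<close>\<close>
  define K where "K n s = Suc (nat \<lfloor>(s - t0) / h n\<rfloor>)" for n s
  have K: "s < G n (K n s)" "G n (K n s) \<le> s + h n" "K n s \<le> Suc n"
    if "t0 \<le> s" "s < t0 + T" for n s
  proof -
    let ?q = "(s - t0) / h n"
    have q: "0 \<le> ?q" "?q * h n = s - t0" using that h[of n] by auto
    have K: "real (K n s) = real_of_int \<lfloor>?q\<rfloor> + 1" using q(1) by (simp add: K_def)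
    have "?q < real (K n s)" "real (K n s) \<le> ?q + 1" unfolding K by linarith+
    then have "?q * h n < real (K n s) * h n" "real (K n s) * h n \<le> (?q + 1) * h n"
      using h[of n] by (simp_all only: mult_less_cancel_right_pos mult_le_cancel_right_pos)
    then show "s < G n (K n s)" "G n (K n s) \<le> s + h n"
      unfolding distrib_right q(2) by (simp_all add: G_def)
    have "?q < real (Suc n)" using that T by (simp add: h_def divide_simps)
    then have "\<lfloor>?q\<rfloor> \<le> int n" by linarith
    then show "K n s \<le> Suc n" by (simp add: K_def)
  qed
  have K_mono: "K n s1 \<le> K n s2" if "s1 \<le> s2" for n s1 s2
    using that h[of n] by (simp add: K_def nat_mono floor_mono divide_right_mono)
  define y where "y n s = (if t0 \<le> s \<and> s < t0 + T then f n (K n s) else x0)" for n s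
  have y: "norm (y n s - x0) \<le> speed * (s + h n - t0)" if "t0 \<le> s" "s < t0 + T" for n s
  proof -
    have "norm (f n (K n s) - x0) \<le> speed * (G n (K n s) - t0)" using f(2) K(3)[OF that] .
    also have "\<dots> \<le> speed * (s + h n - t0)"
      using K(2)[OF that] speed_nonneg by (intro mult_left_mono) auto
    finally show ?thesis using that by (simp add: y_def)
  qed
  have "y n s \<in> cball x0 \<rho>" for n s
  proof (cases "t0 \<le> s \<and> s < t0 + T")
    case True
    have "norm (f n (K n s) - x0) \<le> speed * (G n (K n s) - t0)" using f(2) K(3) True by blast
    also have "\<dots> \<le> speed * T"
    proof (intro mult_left_mono speed_nonneg)
      have "real (K n s) * h n \<le> real (Suc n) * h n"
        using K(3)[of s n] True h[of n] by (intro mult_right_mono) auto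
      then show "G n (K n s) - t0 \<le> T" using G_last[of n] by (simp add: G_def)
    qed
    finally show ?thesis using T True by (simp add: y_def dist_norm norm_minus_commute)
  qed (use rho in \<open>auto simp: y_def\<close>)
  then obtain x where cluster: "\<And>s1 s2 e N. e > 0 \<Longrightarrow>
      \<exists>n\<ge>N. dist (y n s1) (x s1) < e \<and> dist (y n s2) (x s2) < e"
    using pointwise_cluster_function[OF compact_cball] by metis
  have close: "\<exists>n. h n < e \<and> dist (y n s1) (x s1) < e \<and> dist (y n s2) (x s2) < e"
    if e: "e > 0" for e s1 s2
  proof -
    obtain N where N: "inverse (real (Suc N)) < e / T"
      using reals_Archimedean[OF divide_pos_pos[OF e T(1)]] by (elim exE)
    obtain n where n: "n \<ge> N" "dist (y n s1) (x s1) < e" "dist (y n s2) (x s2) < e"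
      using cluster[OF e] by blast
    have "h n \<le> T * inverse (real (Suc N))"
      using n(1) T by (auto simp: h_def divide_inverse intro!: mult_left_mono le_imp_inverse_le)
    also have "\<dots> < T * (e / T)" using N T by (intro mult_strict_left_mono) auto
    finally show ?thesis using n T by auto
  qed
  have cone: "norm (x s - x0) \<le> speed * (s - t0)" if s: "t0 \<le> s" "s < t0 + T" for s
  proof (rule le_if_le_add_small[of 1])
    fix e :: real assume "0 < e"
    then obtain n where n: "h n < e" "dist (y n s) (x s) < e" using close by blast
    have "norm (x s - x0) \<le> dist (y n s) (x s) + norm (y n s - x0)"
      using norm_triangle_ineq[of "x s - y n s" "y n s - x0"] by (simp add: dist_norm norm_minus_commute)
    also have "\<dots> \<le> e + speed * (s + h n - t0)" using n(2) y[OF s, of n] by linarith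
    also have "\<dots> \<le> e + speed * (s + e - t0)"
      using n(1) speed_nonneg by (intro add_left_mono mult_left_mono) auto
    finally show "norm (x s - x0) \<le> speed * (s - t0) + e * (1 + speed)" by (simp add: algebra_simps)
  qed simp
  have lim: "(s2, x s2) \<in> closure {Z. reaches (s1, x s1) Z}"
    if s: "t0 \<le> s1" "s1 < s2" "s2 < t0 + T" for s1 s2
    unfolding closure_approachable
  proof (intro allI impI)
    fix e :: real assume e: "e > 0"
    have t0: "tbar < t0"
      using after[OF subsetD[OF room, of "(t0, x0)"]] T(1) rho by simp
    \<comment> \<open>\<open>k\<close> bounds the growth of distances between two polygons over the whole time interval,
      and \<open>m\<close> is the total weight of the errors of size at most \<open>e / m\<close>\<close>
    define k where "k = sqrt (onorm ((*v) B) / c) * ((t0 + T - tbar) / (t0 - tbar))"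
    have k: "k \<ge> 0"
      using onorm_pos_le[OF matrix_vector_mul_bounded_linear, of B] c_pos t0 T(1) by (simp add: k_def)
    define m where "m = 2 + k * (1 + speed)"
    have m: "m > 0" using k speed_nonneg by (simp add: m_def add_pos_nonneg)
    obtain n where n: "h n < e / m" "dist (y n s1) (x s1) < e / m" "dist (y n s2) (x s2) < e / m"
      using close[of "e / m"] e m by auto
    have s1: "s1 < t0 + T" and s2: "t0 \<le> s2" using s by auto
    let ?k1 = "K n s1" and ?k2 = "K n s2"
    note K1 = K[OF s(1) s1, of n] and K2 = K[OF s2 s(3), of n]
    have k12: "?k1 \<le> ?k2" using K_mono s by simp
    have G_le: "G n j \<le> t0 + T" if "j \<le> Suc n" for j
    proof -
      have "real j * h n \<le> real (Suc n) * h n" using that h[of n] by (intro mult_right_mono) auto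
      then show ?thesis using G_last[of n] by (simp add: G_def)
    qed
    obtain z where z: "euler_step (s1, x s1) (G n ?k1, z)" "norm (z - x0) \<le> speed * (G n ?k1 - t0)"
      using euler_step_in_cone[OF room T(2) s(1) cone[OF s(1) s1] K1(1) G_le[OF K1(3)]]
      by (elim exE conjE)
    define \<theta> where "\<theta> j = G n (?k1 + j)" for j
    have theta0: "\<theta> 0 = G n ?k1" and thetaN: "\<theta> (?k2 - ?k1) = G n ?k2" using k12 by (simp_all add: \<theta>_def)
    have "\<exists>w. w 0 = z \<and> (\<forall>j<?k2 - ?k1. euler_step (\<theta> j, w j) (\<theta> (Suc j), w (Suc j))) \<and>
        (\<forall>j\<le>?k2 - ?k1. t0 \<le> \<theta> j \<and> norm (w j - x0) \<le> speed * (\<theta> j - t0))"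
    proof (rule euler_polygon_exists[OF room T(2)])
      show "t0 \<le> \<theta> 0" using K1(1) s(1) theta0 by simp
      show "norm (z - x0) \<le> speed * (\<theta> 0 - t0)" using z(2) theta0 by simp
      show "\<theta> j < \<theta> (Suc j)" for j using G_mono by (simp add: \<theta>_def)
      show "\<theta> (?k2 - ?k1) \<le> t0 + T" using G_le[OF K2(3)] thetaN by simp
    qed
    then obtain w where w: "w 0 = z" "\<forall>j<?k2 - ?k1. euler_step (\<theta> j, w j) (\<theta> (Suc j), w (Suc j))"
      by (elim exE conjE)
    let ?Z = "(G n ?k2, w (?k2 - ?k1))"
    have "reaches (\<theta> 0, w 0) (\<theta> (?k2 - ?k1), w (?k2 - ?k1))" by (rule euler_polygon_reaches[OF w(2)]) simp
    then have reach: "reaches (s1, x s1) ?Z"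
      using converse_rtranclp_into_rtranclp[of euler_step, OF z(1)] w(1) theta0 thetaN by simp
    have f': "\<forall>j<?k2 - ?k1. euler_step (\<theta> j, f n (?k1 + j)) (\<theta> (Suc j), f n (?k1 + Suc j))"
      using f(1)[of _ n] K2(3) by (simp add: \<theta>_def)
    have y12: "y n s1 = f n ?k1" "y n s2 = f n ?k2" using s s1 s2 by (simp_all add: y_def)
    have "L (w (?k2 - ?k1) - f n (?k1 + (?k2 - ?k1))) / (\<theta> (?k2 - ?k1) - tbar)\<^sup>2 \<le>
        L (w 0 - f n (?k1 + 0)) / (\<theta> 0 - tbar)\<^sup>2"
      by (rule euler_polygons_nonexpansive[OF f' w(2)]) simp
    then have exp: "L (w (?k2 - ?k1) - y n s2) / (G n ?k2 - tbar)\<^sup>2 \<le> L (z - y n s1) / (G n ?k1 - tbar)\<^sup>2"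
      using k12 by (simp add: thetaN theta0 w(1) y12)
    define a1 a2 where "a1 = G n ?k1 - tbar" and "a2 = G n ?k2 - tbar"
    have a: "t0 - tbar \<le> a1" "0 < a1" "0 < a2" "a2 \<le> t0 + T - tbar"
      using K1(1) K2(1) G_le[OF K2(3)] s t0 by (auto simp: a1_def a2_def)
    have "L (w (?k2 - ?k1) - y n s2) \<le> (a2 / a1)\<^sup>2 * L (z - y n s1)"
      using exp a unfolding a1_def[symmetric] a2_def[symmetric]
      by (simp add: divide_simps power_divide) (simp add: algebra_simps)
    then have "norm (w (?k2 - ?k1) - y n s2) \<le> sqrt (onorm ((*v) B) / c) * (a2 / a1) * norm (z - y n s1)"
      using a by (intro L_controls_norm) auto
    also have "\<dots> \<le> k * norm (z - y n s1)"
      unfolding k_def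
      using onorm_pos_le[OF matrix_vector_mul_bounded_linear, of B] c_pos t0 a
      by (intro mult_right_mono mult_left_mono frac_le) auto
    also have "\<dots> \<le> k * ((1 + speed) * (e / m))"
    proof (intro mult_left_mono k)
      have X1: "(s1, x s1) \<in> D" using z(1) by (simp add: euler_step_def)
      have "norm (z - x s1) \<le> speed * (G n ?k1 - s1)"
        using reaches_bounds[OF r_into_rtranclp[of euler_step, OF z(1)] X1] by simp
      also have "\<dots> \<le> speed * (e / m)"
        using K1(2) n(1) speed_nonneg by (intro mult_left_mono) auto
      finally have "norm (z - x s1) \<le> speed * (e / m)" .
      moreover have "norm (z - y n s1) \<le> norm (z - x s1) + dist (y n s1) (x s1)"
        using norm_triangle_ineq[of "z - x s1" "x s1 - y n s1"] by (simp add: dist_norm norm_minus_commute)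
      ultimately have "norm (z - y n s1) \<le> speed * (e / m) + e / m" using n(2) by linarith
      then show "norm (z - y n s1) \<le> (1 + speed) * (e / m)" by (simp only: distrib_right mult_1_left add.commute)
    qed
    finally have w2: "norm (w (?k2 - ?k1) - y n s2) \<le> k * (1 + speed) * (e / m)"
      by (simp only: mult.assoc)
    have "dist ?Z (s2, x s2) \<le> \<bar>G n ?k2 - s2\<bar> + norm (w (?k2 - ?k1) - x s2)"
      using norm_Pair_le[of "G n ?k2 - s2" "w (?k2 - ?k1) - x s2"] by (simp add: dist_norm)
    also have "norm (w (?k2 - ?k1) - x s2) \<le> norm (w (?k2 - ?k1) - y n s2) + dist (y n s2) (x s2)"
      using norm_triangle_ineq[of "w (?k2 - ?k1) - y n s2" "y n s2 - x s2"] by (simp add: dist_norm)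
    finally have "dist ?Z (s2, x s2) < e / m + (k * (1 + speed) * (e / m) + e / m)"
      using K2(1,2) n(1,3) w2 by linarith
    also have "\<dots> = m * (e / m)" unfolding m_def by (simp only: distrib_right)
    also have "\<dots> = e" using m by simp
    finally show "\<exists>Y\<in>{Z. reaches (s1, x s1) Z}. dist Y (s2, x s2) < e" using reach by blast
  qed
  have "(s, x s) \<in> D" if s: "t0 \<le> s" "s < t0 + T" for s
  proof -
    have "norm (x s - x0) \<le> speed * T"
      using cone[OF s] mult_left_mono[OF _ speed_nonneg, of "s - t0" T] s(2) by linarith
    then show ?thesis
      using subsetD[OF room, of "(s, x s)"] s T by (simp add: dist_norm norm_minus_commute)
  qed
  moreover have "x t0 = x0" using cone[of t0] T(1) by simp
  ultimately show thesis using that lim unfolding euler_limit_def by blast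
qed

section \<open>Energy-minimizing characteristics\<close>

text \<open>
  The right derivative of \<open>L(y - x) / \<tau>\<^sup>2\<close> is nonpositive by \<open>supergradient_one_sided_lipschitz\<close>.
\<close>

lemma right_solutions_unique:
  assumes T: "t0 \<le> s" "s < t0 + T"
    and xc: "continuous_on {t0..s} x" and yc: "continuous_on {t0..s} y"
    and x: "\<And>r. t0 \<le> r \<Longrightarrow> r < s \<Longrightarrow> (r, x r) \<in> D \<and>
      (\<exists>P\<in>supergradients (r, x r). (x has_vector_derivative A *v snd P) (at_right r))"
    and y: "\<And>r. t0 \<le> r \<Longrightarrow> r < s \<Longrightarrow> (r, y r) \<in> D \<and>
      (\<exists>P\<in>supergradients (r, y r). (y has_vector_derivative A *v snd P) (at_right r))"
    and tbar: "tbar < t0" and init: "x t0 = y t0"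
  shows "x s = y s"
proof -
  define w where "w r = y r - x r" for r
  have "L (w s) / (s - tbar)\<^sup>2 - L (w t0) / (t0 - tbar)\<^sup>2 \<le> 0 * (s - t0)"
  proof (rule right_derivative_le_imp_increment_le[OF T(1)])
    show "continuous_on {t0..s} (\<lambda>r. L (w r) / (r - tbar)\<^sup>2)"
      unfolding w_def using tbar by (intro continuous_intros xc yc) auto
    fix r assume r: "t0 \<le> r" "r < s"
    obtain P where P: "(r, x r) \<in> D" "P \<in> supergradients (r, x r)"
        "(x has_vector_derivative A *v snd P) (at_right r)"
      using x[OF r] by blast
    obtain Q where Q: "(r, y r) \<in> D" "Q \<in> supergradients (r, y r)"
        "(y has_vector_derivative A *v snd Q) (at_right r)"
      using y[OF r] by blast
    let ?p = "snd Q - snd P" and ?a = "r - tbar"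
    have a: "?a > 0" using r(1) tbar by simp
    have dw: "(w has_vector_derivative A *v ?p) (at_right r)"
      unfolding w_def matrix_vector_mult_diff_distrib
      by (intro has_vector_derivative_diff P Q)
    have "((\<lambda>r. B *v w r) has_vector_derivative ?p) (at_right r)"
      using bounded_linear.has_vector_derivative[OF matrix_vector_mul_bounded_linear dw, of B]
      by (simp add: BA)
    from bounded_bilinear.has_vector_derivative[OF bounded_bilinear_inner this dw]
    have "((\<lambda>r. (B *v w r) \<bullet> w r) has_vector_derivative (B *v w r) \<bullet> (A *v ?p) + ?p \<bullet> w r) (at_right r)" .
    moreover have "(B *v w r) \<bullet> (A *v ?p) = ?p \<bullet> w r"
      using B_sym[of "w r" "A *v ?p"] by (simp add: BA inner_commute)
    ultimately have "((\<lambda>r. (B *v w r) \<bullet> w r) has_real_derivative 2 * (?p \<bullet> w r)) (at_right r)"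
      by (simp add: has_real_derivative_iff_has_vector_derivative)
    then have dL: "((\<lambda>r. L (w r)) has_real_derivative ?p \<bullet> w r) (at_right r)"
      unfolding lagrangian_def by (auto intro!: derivative_eq_intros)
    have "((\<lambda>r. L (w r) / (r - tbar)\<^sup>2) has_real_derivative
        ((?p \<bullet> w r) * ?a\<^sup>2 - L (w r) * (2 * ?a)) / (?a\<^sup>2 * ?a\<^sup>2)) (at_right r)"
      by (rule DERIV_divide[OF dL]) (use a in \<open>auto intro!: derivative_eq_intros\<close>)
    moreover have "((?p \<bullet> w r) * ?a\<^sup>2 - L (w r) * (2 * ?a)) / (?a\<^sup>2 * ?a\<^sup>2) \<le> 0"
    proof -
      have "?a * (?p \<bullet> w r) \<le> 2 * L (w r)"
        using supergradient_one_sided_lipschitz[OF P(1,2) Q(1,2)] by (simp add: age_def w_def)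
      then have "?a * (?a * (?p \<bullet> w r)) \<le> ?a * (2 * L (w r))" using a by (intro mult_left_mono) auto
      moreover have "(?p \<bullet> w r) * ?a\<^sup>2 - L (w r) * (2 * ?a) = ?a * (?a * (?p \<bullet> w r)) - ?a * (2 * L (w r))"
        by algebra
      ultimately show ?thesis by (intro divide_nonpos_nonneg) auto
    qed
    ultimately show "\<exists>d\<le>0. ((\<lambda>r. L (w r) / (r - tbar)\<^sup>2) has_real_derivative d) (at_right r)"
      by blast
  qed
  then have "L (w s) / (s - tbar)\<^sup>2 \<le> 0" using init by (simp add: w_def)
  then have "L (w s) \<le> 0" using T(1) tbar by (simp add: divide_le_0_iff)
  then have "c / 2 * (norm (w s))\<^sup>2 \<le> 0" using L_ge[of "w s"] by linarith
  then show ?thesis using c_pos by (simp add: mult_le_0_iff w_def)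
qed

lemma euler_limit_lipschitz:
  assumes E: "euler_limit t0 T x"
  shows "(1 + speed)-lipschitz_on {t0..<t0 + T} (\<lambda>s. (s, x s))"
proof (rule lipschitz_onI)
  have *: "dist (s, x s) (r, x r) \<le> (1 + speed) * dist s r" if "r < s" "t0 \<le> r" "s < t0 + T" for r s
  proof -
    have "norm (snd (s, x s) - snd (r, x r)) \<le> speed * (fst (s, x s) - fst (r, x r))"
      by (rule closure_reaches_bounds(1)[OF euler_limitD(1)[OF E] euler_limitD(1)[OF E] euler_limitD(2)[OF E]]) (use that in auto)
    then show ?thesis
      using dist_le_of_speed[of "(s, x s)" "(r, x r)"] that by (simp add: dist_real_def)
  qed
  fix r s assume "r \<in> {t0..<t0 + T}" "s \<in> {t0..<t0 + T}"
  then show "dist (r, x r) (s, x s) \<le> (1 + speed) * dist r s"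
    using *[of r s] *[of s r] by (cases r s rule: linorder_cases) (auto simp: dist_commute)
qed (use speed_nonneg in simp)

lemma euler_limit_right_derivative:
  assumes E: "euler_limit t0 T x" and s: "t0 \<le> s" "s < t0 + T"
  shows "(x has_vector_derivative A *v snd (energy_minimizer (s, x s))) (at_right s)"
  unfolding has_vector_derivative_def has_derivative_within_alt
proof (intro conjI allI impI)
  let ?v = "A *v snd (energy_minimizer (s, x s))"
  show "bounded_linear (\<lambda>h. h *\<^sub>R ?v)" by (rule bounded_linear_scaleR_left)
  fix e :: real assume e: "e > 0"
  obtain d where d: "d > 0" "\<forall>Y. Y \<in> closure {Z. reaches (s, x s) Z} \<longrightarrow> fst Y - fst (s, x s) < d \<longrightarrow>
      norm (snd Y - snd (s, x s) - (fst Y - fst (s, x s)) *\<^sub>R ?v) \<le> e * (fst Y - fst (s, x s))"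
    using closure_reaches_initial_velocity[OF euler_limitD(1)[OF E s] e] by (elim exE conjE)
  show "\<exists>d>0. \<forall>y\<in>{s<..}. norm (y - s) < d \<longrightarrow> norm (x y - x s - (y - s) *\<^sub>R ?v) \<le> e * norm (y - s)"
  proof (intro exI[of _ "min d (t0 + T - s)"] conjI ballI impI)
    show "min d (t0 + T - s) > 0" using d(1) s by simp
    fix y assume y: "y \<in> {s<..}" "norm (y - s) < min d (t0 + T - s)"
    then have "(y, x y) \<in> closure {Z. reaches (s, x s) Z}" using s by (intro euler_limitD(2)[OF E]) auto
    from d(2)[rule_format, OF this] y
    show "norm (x y - x s - (y - s) *\<^sub>R ?v) \<le> e * norm (y - s)" by simp
  qed
qed

text \<open>
  The energy at later points of the curve does not exceed the energy at \<open>s\<close>, so \<open>low_energy_near_minimizer\<close>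
  applies to their minimizers.
\<close>
lemma euler_limit_minimizer_right_continuous:
  assumes E: "euler_limit t0 T x" and s: "t0 \<le> s" "s < t0 + T"
  shows "continuous (at_right s) (\<lambda>r. energy_minimizer (r, x r))"
  unfolding continuous_within tendsto_iff
proof (intro allI impI)
  fix e :: real assume e: "e > 0"
  obtain d where d: "d > 0" "\<forall>Y\<in>D. dist Y (s, x s) < d \<longrightarrow> (\<forall>P\<in>supergradients Y.
      (age Y)\<^sup>2 * F P \<le> energy (s, x s) \<longrightarrow> dist P (energy_minimizer (s, x s)) < e)"
    using low_energy_near_minimizer[OF euler_limitD(1)[OF E s] e] by (elim exE conjE)
  define d' where "d' = min (d / (1 + speed)) (t0 + T - s)"
  have sp: "1 + speed > 0" using speed_nonneg by simp
  have d': "d' > 0" using d(1) sp s by (simp add: d'_def)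
  have "dist (energy_minimizer (r, x r)) (energy_minimizer (s, x s)) < e" if r: "s < r" "r < s + d'" for r
  proof -
    have rT: "r < t0 + T" "t0 \<le> r" using r s by (auto simp: d'_def)
    have R: "(r, x r) \<in> D" using rT by (intro euler_limitD(1)[OF E])
    have "dist (r, x r) (s, x s) \<le> (1 + speed) * dist r s"
      using lipschitz_onD[OF euler_limit_lipschitz[OF E], of r s] rT s by simp
    also have "\<dots> < d"
    proof -
      have "dist r s < d / (1 + speed)" using r by (simp add: dist_real_def d'_def)
      then show ?thesis using sp by (simp add: pos_less_divide_eq mult.commute)
    qed
    finally have "dist (r, x r) (s, x s) < d" .
    moreover have "energy (r, x r) \<le> energy (s, x s)"
      by (rule closure_reaches_bounds(2)[OF euler_limitD(1)[OF E s] R euler_limitD(2)[OF E]]) (use r rT s in auto)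
    ultimately show ?thesis
      using d(2) R energy_minimizer_in[OF R] by (simp add: energy_def)
  qed
  then show "\<forall>\<^sub>F r in at_right s. dist (energy_minimizer (r, x r)) (energy_minimizer (s, x s)) < e"
    unfolding eventually_at_right_field using d' by (intro exI[of _ "s + d'"]) auto
qed

lemma has_min_energy_minimizer:
  assumes "X \<in> D"
  shows "has_min F (superdifferential u X) (F (energy_minimizer X))"
  unfolding has_min_def superdifferential_eq_supergradients[OF assms]
  using energy_minimizer_in[OF assms] energy_minimizer_le[OF assms] by blast

lemma gradient_hamiltonian_A: "gradient (hamiltonian A) p = A *v p"
  by (rule gradient_hamiltonian) (use spd in \<open>simp add: sym_pos_def_def\<close>)

theorem energy_min_characteristic_exists:
  assumes D: "D \<subseteq> cylinder \<Omega>'" and T: "T > 0" and E: "euler_limit t0 T x"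
  shows "energy_min_characteristic A \<Omega>' u (t0, x t0) T (\<lambda>s. (s, x s))"
proof -
  have "energy_minimizer (s, x s) \<in> superdifferential u (s, x s) \<and>
      has_min F (superdifferential u (s, x s)) (F (energy_minimizer (s, x s))) \<and>
      ((\<lambda>s. (s, x s)) has_vector_derivative
        (1, gradient (hamiltonian A) (snd (energy_minimizer (s, x s))))) (at_right s) \<and>
      continuous (at_right s)
        (\<lambda>r. (1::real, gradient (hamiltonian A) (snd (energy_minimizer (r, x r)))))"
    if s: "s \<in> {t0..<t0 + T}" for s
  proof (intro conjI)
    have s: "t0 \<le> s" "s < t0 + T" using s by auto
    note X = euler_limitD(1)[OF E s]
    show "energy_minimizer (s, x s) \<in> superdifferential u (s, x s)"
      using energy_minimizer_in[OF X] superdifferential_eq_supergradients[OF X] by simp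
    show "has_min F (superdifferential u (s, x s)) (F (energy_minimizer (s, x s)))"
      by (rule has_min_energy_minimizer[OF X])
    show "((\<lambda>s. (s, x s)) has_vector_derivative
        (1, gradient (hamiltonian A) (snd (energy_minimizer (s, x s))))) (at_right s)"
      unfolding gradient_hamiltonian_A
      by (intro has_vector_derivative_Pair has_vector_derivative_id
          euler_limit_right_derivative[OF E s])
    show "continuous (at_right s)
        (\<lambda>r. (1::real, gradient (hamiltonian A) (snd (energy_minimizer (r, x r)))))"
      unfolding gradient_hamiltonian_A
      by (intro continuous_intros bounded_linear.continuous[OF matrix_vector_mul_bounded_linear]
          euler_limit_minimizer_right_continuous[OF E s])
  qed
  then have "\<exists>P. \<forall>s\<in>{t0..<t0 + T}. P s \<in> superdifferential u (s, x s) \<and>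
      has_min F (superdifferential u (s, x s)) (F (P s)) \<and>
      ((\<lambda>s. (s, x s)) has_vector_derivative (1, gradient (hamiltonian A) (snd (P s)))) (at_right s) \<and>
      continuous (at_right s) (\<lambda>r. (1::real, gradient (hamiltonian A) (snd (P r))))"
    by (intro exI[of _ "\<lambda>s. energy_minimizer (s, x s)"] ballI)
  moreover have "(\<lambda>s. (s, x s)) ` {t0..<t0 + T} \<subseteq> cylinder \<Omega>'"
    using D euler_limitD(1)[OF E] by auto
  ultimately show ?thesis
    unfolding energy_min_characteristic_def Let_def fst_conv
    using T euler_limit_lipschitz[OF E] by blast
qed

lemma energy_min_characteristicE:
  assumes "energy_min_characteristic A \<Omega>' u (t0, x0) T \<xi>"
  obtains K P where "\<xi> t0 = (t0, x0)" and "K-lipschitz_on {t0..<t0 + T} \<xi>"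
    and "\<And>r. t0 \<le> r \<Longrightarrow> r < t0 + T \<Longrightarrow> \<xi> r \<in> cylinder \<Omega>'"
    and "\<And>r. t0 \<le> r \<Longrightarrow> r < t0 + T \<Longrightarrow> P r \<in> superdifferential u (\<xi> r)"
    and "\<And>r. t0 \<le> r \<Longrightarrow> r < t0 + T \<Longrightarrow>
      (\<xi> has_vector_derivative (1, A *v snd (P r))) (at_right r)"
proof -
  obtain K P where *: "\<xi> t0 = (t0, x0)" "K-lipschitz_on {t0..<t0 + T} \<xi>"
      "\<xi> ` {t0..<t0 + T} \<subseteq> cylinder \<Omega>'"
      "\<forall>s\<in>{t0..<t0 + T}. P s \<in> superdifferential u (\<xi> s) \<and>
         has_min F (superdifferential u (\<xi> s)) (F (P s)) \<and>
         (\<xi> has_vector_derivative (1, A *v snd (P s))) (at_right s) \<and>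
         continuous (at_right s) (\<lambda>r. (1::real, A *v snd (P r)))"
    using assms unfolding energy_min_characteristic_def Let_def gradient_hamiltonian_A fst_conv
    by (elim exE conjE)
  show thesis by (rule that[OF *(1,2), of P]) (use *(3,4) in \<open>auto simp: image_subset_iff\<close>)
qed

text \<open>
  A priori the characteristic may leave \<open>D\<close>.  It stays in the space-time domain, on which the Lipschitz
  constant of \<open>u\<close> bounds every superdifferential and thereby the velocity; this confines it to the cone.
\<close>
lemma energy_min_characteristic_in_cone:
  assumes U: "open (cylinder \<Omega>')" and lipU: "C-lipschitz_on (cylinder \<Omega>') u"
    and char: "energy_min_characteristic A \<Omega>' u (t0, x0) T \<xi>"
    and s: "t0 \<le> s" "s < t0 + T"
  shows "fst (\<xi> s) = s" and "norm (snd (\<xi> s) - x0) \<le> speed * (s - t0)"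
proof -
  obtain K P where \<xi>0: "\<xi> t0 = (t0, x0)" and K: "K-lipschitz_on {t0..<t0 + T} \<xi>"
    and U\<xi>: "\<And>r. t0 \<le> r \<Longrightarrow> r < t0 + T \<Longrightarrow> \<xi> r \<in> cylinder \<Omega>'"
    and P: "\<And>r. t0 \<le> r \<Longrightarrow> r < t0 + T \<Longrightarrow> P r \<in> superdifferential u (\<xi> r)"
    and d: "\<And>r. t0 \<le> r \<Longrightarrow> r < t0 + T \<Longrightarrow>
      (\<xi> has_vector_derivative (1, A *v snd (P r))) (at_right r)"
    by (rule energy_min_characteristicE[OF char]) (rule that)
  have cont: "continuous_on {t0..s} \<xi>"
    by (rule continuous_on_subset[OF lipschitz_on_continuous_on[OF K]]) (use s(2) in auto)
  have dfst: "((\<lambda>r. fst (\<xi> r)) has_real_derivative 1) (at_right r)"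
    and dsnd: "((\<lambda>r. snd (\<xi> r)) has_vector_derivative A *v snd (P r)) (at_right r)"
    if "t0 \<le> r" "r < s" for r
    using bounded_linear.has_vector_derivative[OF bounded_linear_fst d[of r]]
      bounded_linear.has_vector_derivative[OF bounded_linear_snd d[of r]] that s(2)
    by (simp_all add: has_real_derivative_iff_has_vector_derivative)
  have "fst (\<xi> s) - fst (\<xi> t0) \<le> 1 * (s - t0)"
    by (rule right_derivative_le_imp_increment_le[OF s(1)])
      (use dfst in \<open>auto intro!: continuous_intros cont\<close>)
  moreover have "- fst (\<xi> s) - - fst (\<xi> t0) \<le> (- 1) * (s - t0)"
    by (rule right_derivative_le_imp_increment_le[OF s(1)])
      (use dfst in \<open>auto intro!: continuous_intros cont exI[of _ "-1"] derivative_eq_intros\<close>)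
  ultimately show "fst (\<xi> s) = s" using \<xi>0 by simp
  have "norm (snd (\<xi> s) - snd (\<xi> t0)) \<le> speed * (s - t0)"
  proof (rule norm_increment_le_of_right_derivative[OF s(1)])
    show "continuous_on {t0..s} (\<lambda>r. snd (\<xi> r))" by (intro continuous_intros cont)
    fix r assume r: "t0 \<le> r" "r < s"
    have "norm (P r) \<le> C"
      using norm_superdifferential_le[OF lipU U U\<xi> P] r s(2) by simp
    then have "norm (A *v snd (P r)) \<le> speed"
      using norm_snd_le[of "snd (P r)" "fst (P r)"] by (intro velocity_le_speed) simp
    then show "\<exists>v. norm v \<le> speed \<and> ((\<lambda>r. snd (\<xi> r)) has_vector_derivative v) (at_right r)"
      using dsnd[OF r] by blast
  qed
  then show "norm (snd (\<xi> s) - x0) \<le> speed * (s - t0)" using \<xi>0 by simp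
qed

theorem energy_min_characteristic_unique:
  assumes room: "{t0..t0 + T} \<times> cball x0 \<rho> \<subseteq> D" and T: "speed * T < \<rho>"
    and U: "open (cylinder \<Omega>')" and lipU: "C-lipschitz_on (cylinder \<Omega>') u"
    and E: "euler_limit t0 T x" and x0: "x t0 = x0"
    and char: "energy_min_characteristic A \<Omega>' u (t0, x0) T \<xi>"
    and s: "t0 \<le> s" "s < t0 + T"
  shows "\<xi> s = (s, x s)"
proof -
  note cone = energy_min_characteristic_in_cone[OF U lipU char]
  have \<xi>: "\<xi> r = (r, snd (\<xi> r))" if "t0 \<le> r" "r < t0 + T" for r
    using cone(1)[OF that] by (simp add: prod_eq_iff)
  have \<xi>D: "(r, snd (\<xi> r)) \<in> D" if r: "t0 \<le> r" "r < t0 + T" for r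
  proof -
    have "norm (snd (\<xi> r) - x0) \<le> speed * T"
      using cone(2)[OF r] mult_left_mono[OF _ speed_nonneg, of "r - t0" T] r(2) by linarith
    then show ?thesis
      using subsetD[OF room, of "(r, snd (\<xi> r))"] r T by (simp add: dist_norm norm_minus_commute)
  qed
  obtain K P where \<xi>0: "\<xi> t0 = (t0, x0)" and K: "K-lipschitz_on {t0..<t0 + T} \<xi>"
    and "\<And>r. t0 \<le> r \<Longrightarrow> r < t0 + T \<Longrightarrow> \<xi> r \<in> cylinder \<Omega>'"
    and P: "\<And>r. t0 \<le> r \<Longrightarrow> r < t0 + T \<Longrightarrow> P r \<in> superdifferential u (\<xi> r)"
    and d: "\<And>r. t0 \<le> r \<Longrightarrow> r < t0 + T \<Longrightarrow>
      (\<xi> has_vector_derivative (1, A *v snd (P r))) (at_right r)"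
    by (rule energy_min_characteristicE[OF char]) (rule that)
  have "snd (\<xi> s) = x s"
  proof (rule right_solutions_unique[OF s])
    have sub: "{t0..s} \<subseteq> {t0..<t0 + T}" using s(2) by auto
    show "continuous_on {t0..s} (\<lambda>r. snd (\<xi> r))"
      by (intro continuous_intros continuous_on_subset[OF lipschitz_on_continuous_on[OF K] sub])
    have "continuous_on {t0..s} (\<lambda>r. snd (r, x r))"
      by (intro continuous_on_snd
          continuous_on_subset[OF lipschitz_on_continuous_on[OF euler_limit_lipschitz[OF E]] sub])
    then show "continuous_on {t0..s} x" by simp
    show "tbar < t0" using after[OF \<xi>D[of t0]] s by simp
    show "snd (\<xi> t0) = x t0" using \<xi>0 x0 by simp
  next
    fix r assume "t0 \<le> r" "r < s"
    then have r: "t0 \<le> r" "r < t0 + T" using s(2) by auto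
    have "P r \<in> supergradients (r, snd (\<xi> r))"
      using P[OF r] \<xi>[OF r] superdifferential_eq_supergradients[OF \<xi>D[OF r]] by simp
    moreover have "((\<lambda>r. snd (\<xi> r)) has_vector_derivative A *v snd (P r)) (at_right r)"
      using bounded_linear.has_vector_derivative[OF bounded_linear_snd d[OF r]] by simp
    ultimately show "(r, snd (\<xi> r)) \<in> D \<and> (\<exists>P\<in>supergradients (r, snd (\<xi> r)).
        ((\<lambda>r. snd (\<xi> r)) has_vector_derivative A *v snd P) (at_right r))"
      using \<xi>D[OF r] by blast
    show "(r, x r) \<in> D \<and> (\<exists>P\<in>supergradients (r, x r). (x has_vector_derivative A *v snd P) (at_right r))"
      using euler_limitD(1)[OF E r] energy_minimizer_in euler_limit_right_derivative[OF E r] by blast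
  qed
  then show ?thesis using \<xi>[OF s] by simp
qed

theorem energy_decay:
  assumes room: "{t0..t0 + T} \<times> cball x0 \<rho> \<subseteq> D" and T: "T > 0" "speed * T < \<rho>"
    and D: "D \<subseteq> cylinder \<Omega>'" and U: "open (cylinder \<Omega>')" and lipU: "C-lipschitz_on (cylinder \<Omega>') u"
  shows "(\<exists>\<xi>. energy_min_characteristic A \<Omega>' u (t0, x0) T \<xi>) \<and>
    (\<forall>\<xi>. energy_min_characteristic A \<Omega>' u (t0, x0) T \<xi> \<longrightarrow>
      (\<forall>s\<in>{t0..<t0 + T}. \<exists>m m0. has_min F (superdifferential u (\<xi> s)) m \<and>
         has_min F (superdifferential u (t0, x0)) m0 \<and> m \<le> ((t0 - tbar) / (s - tbar))\<^sup>2 * m0))"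
proof -
  obtain x where E: "euler_limit t0 T x" and x0: "x t0 = x0"
    using euler_limit_exists[OF room T] by blast
  have X0: "(t0, x0) \<in> D" using euler_limitD(1)[OF E, of t0] x0 T(1) by simp
  have "\<exists>m m0. has_min F (superdifferential u (\<xi> s)) m \<and>
      has_min F (superdifferential u (t0, x0)) m0 \<and> m \<le> ((t0 - tbar) / (s - tbar))\<^sup>2 * m0"
    if char: "energy_min_characteristic A \<Omega>' u (t0, x0) T \<xi>" and "s \<in> {t0..<t0 + T}" for \<xi> s
  proof -
    have s: "t0 \<le> s" "s < t0 + T" using that(2) by auto
    note X = euler_limitD(1)[OF E s]
    have \<xi>s: "\<xi> s = (s, x s)"
      by (rule energy_min_characteristic_unique[OF room T(2) U lipU E x0 char s])
    have "energy (s, x s) \<le> energy (t0, x0)"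
    proof (cases "s = t0")
      case False
      then have "(s, x s) \<in> closure {Z. reaches (t0, x0) Z}"
        using euler_limitD(2)[OF E, of t0 s] s x0 by simp
      then show ?thesis by (rule closure_reaches_bounds(2)[OF X0 X])
    qed (use x0 in simp)
    moreover have "(s - tbar)\<^sup>2 > 0" using age_pos[OF X] by (simp add: age_def)
    ultimately have "F (energy_minimizer (s, x s)) \<le>
        ((t0 - tbar) / (s - tbar))\<^sup>2 * F (energy_minimizer (t0, x0))"
      by (simp add: energy_def age_def power_divide pos_le_divide_eq mult.commute)
    then show ?thesis
      unfolding \<xi>s using has_min_energy_minimizer[OF X] has_min_energy_minimizer[OF X0] by blast
  qed
  then show ?thesis
    using energy_min_characteristic_exists[OF D T(1) E] x0 by blast
qed

end

section \<open>Decay of the energy on a ball\<close>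

theorem theorem4p1:
  fixes A :: "real^'n^'n"
    and \<Omega> :: "(real^'n) set"
    and \<phi> u :: "real \<times> (real^'n) \<Rightarrow> real"
    and X' :: "real \<times> (real^'n)"
    and R tbar :: real
  assumes "sym_pos_def A"
    and "open \<Omega>"
    and "\<exists>C. C-lipschitz_on (closure (cylinder \<Omega>)) \<phi>"
    and "compatible A \<Omega> \<phi>"
    and "\<exists>C. C-lipschitz_on (closure (cylinder \<Omega>)) u"
    and "viscosity_solution (full_hamiltonian A) (cylinder \<Omega>) u"
    and "\<forall>X\<in>frontier (cylinder \<Omega>). u X = \<phi> X"
    and "X' \<in> cylinder \<Omega>"
    and "R > 0"
    and "0 < tbar" and "tbar < fst X'"
    and "closure (upper_ball tbar X' R) \<subseteq> cylinder \<Omega>"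
    and "\<forall>(t, x)\<in>upper_ball tbar X' R.
           has_min (\<lambda>y. (t - tbar) * lagrangian A ((x - y) /\<^sub>R (t - tbar)) + u (tbar, y)) \<Omega> (u (t, x))"
  shows "\<exists>T'>0. \<forall>(t0, x0)\<in>upper_ball tbar X' (R / 2).
           (\<exists>\<xi>. energy_min_characteristic A \<Omega> u (t0, x0) T' \<xi>) \<and>
           (\<forall>\<xi>. energy_min_characteristic A \<Omega> u (t0, x0) T' \<xi> \<longrightarrow>
             (\<forall>s\<in>{t0..<t0 + T'}.
               \<exists>m m0. has_min (full_hamiltonian A) (superdifferential u (\<xi> s)) m \<and>
                      has_min (full_hamiltonian A) (superdifferential u (t0, x0)) m0 \<and>
                      m \<le> ((t0 - tbar) / (s - tbar))\<^sup>2 * m0))"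
proof -
  let ?D = "upper_ball tbar X' R"
  obtain c where c: "c > 0" "\<And>q. c * (norm q)\<^sup>2 \<le> (matrix_inv A *v q) \<bullet> q"
    using sym_pos_def_inverse_coercive[OF assms(1)] by blast
  obtain C where C: "C-lipschitz_on (closure (cylinder \<Omega>)) u" using assms(5) by blast
  have DQ: "?D \<subseteq> cylinder \<Omega>" using assms(12) closure_subset by blast
  have lipQ: "C-lipschitz_on (cylinder \<Omega>) u"
    using lipschitz_on_subset[OF C closure_subset] .
  have openQ: "open (cylinder \<Omega>)" unfolding cylinder_def by (intro open_Times assms(2)) simp
  interpret hopf_region A ?D u "\<lambda>y. u (tbar, y)" \<Omega> tbar C c
  proof
    show "open ?D" unfolding upper_ball_def by (intro open_Int open_Times) simp_all
    show "convex ?D" unfolding upper_ball_def by (intro convex_Int convex_Times convex_ball) simp_all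
    show "tbar < fst X" if "X \<in> ?D" for X using that by (auto simp: upper_ball_def)
    show "C-lipschitz_on ?D u" using lipschitz_on_subset[OF lipQ DQ] .
    show "has_min (\<lambda>y. (t - tbar) * lagrangian A ((x - y) /\<^sub>R (t - tbar)) + u (tbar, y)) \<Omega> (u (t, x))"
      if "(t, x) \<in> ?D" for t x using assms(13) that by blast
  qed (use assms(1) c in auto)
  \<comment> \<open>Within time \<open>T\<close> at speed \<open>speed\<close> neither time nor space advances by more than \<open>R / 4\<close>.\<close>
  define T where "T = R / (8 * (1 + speed))"
  have sp: "1 + speed > 0" using speed_nonneg by simp
  have "(1 + speed) * T = R * (1 + speed) / (8 * (1 + speed))"
    by (simp only: T_def times_divide_eq_right mult.commute[of "1 + speed" R])
  also have "\<dots> = R / 8" using sp by (simp only: mult_divide_mult_cancel_right)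
  finally have "(1 + speed) * T = R / 8" .
  moreover have T0: "T > 0" using sp assms(9) by (simp add: T_def)
  moreover have "0 \<le> speed * T" using speed_nonneg T0 by simp
  ultimately have T: "T > 0" "T \<le> R / 8" "speed * T < R / 4"
    using assms(9) unfolding distrib_right by linarith+
  have "{t0..t0 + T} \<times> cball x0 (R / 4) \<subseteq> ?D" if X0: "(t0, x0) \<in> upper_ball tbar X' (R / 2)" for t0 x0
  proof
    fix Y assume Y: "Y \<in> {t0..t0 + T} \<times> cball x0 (R / 4)"
    have "dist Y (t0, x0) \<le> dist (fst Y) t0 + dist (snd Y) x0"
      using norm_Pair_le[of "fst Y - t0" "snd Y - x0"] by (cases Y) (simp add: dist_norm)
    also have "\<dots> \<le> T + R / 4" using Y by (auto simp: dist_real_def dist_commute)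
    also have "\<dots> < R / 2" using T(2) assms(9) by simp
    finally have "dist X' Y < R"
      using X0 dist_triangle_half_r[of "(t0, x0)" X' R Y] by (auto simp: upper_ball_def dist_commute)
    then show "Y \<in> ?D" using X0 Y by (auto simp: upper_ball_def)
  qed
  then have "case X0 of (t0, x0) \<Rightarrow>
      (\<exists>\<xi>. energy_min_characteristic A \<Omega> u (t0, x0) T \<xi>) \<and>
      (\<forall>\<xi>. energy_min_characteristic A \<Omega> u (t0, x0) T \<xi> \<longrightarrow>
        (\<forall>s\<in>{t0..<t0 + T}. \<exists>m m0. has_min F (superdifferential u (\<xi> s)) m \<and>
           has_min F (superdifferential u (t0, x0)) m0 \<and> m \<le> ((t0 - tbar) / (s - tbar))\<^sup>2 * m0))"
    if "X0 \<in> upper_ball tbar X' (R / 2)" for X0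
    using energy_decay[OF _ T(1,3) DQ openQ lipQ] that by (cases X0) simp
  then show ?thesis using T(1) by blast
qed

end
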